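(* Let $X=(X_n)_{n\in\mathbb{Z}}$ be an i.i.d. sequence of random variables with values in $\{-1,0,1,2,\dots\}$ with $0<\mathbb{P}[X_0=-1]\le1$ and $\mathbb{E}[X_0]=0$. Let $\pi$ be the distribution of $X_0+1$. Let $[\mathbf{T},0]$ be the connected component of $0$ in the record graph of $X$, rooted at $0$ and viewed as an ordered Family Tree in which children are ordered by the order of $\mathbb{Z}$. Then $[\mathbf{T},0]$ has the distribution of the ordered Eternal Galton-Watson Tree $EGWT(\pi)$.
   Context: For a sequence $x=(x_n)_{n\in\mathbb{Z}}$ write $y(j,k)=\sum_{l=j}^{k-1}x_l$ for $j<k$. The record map is $R_x(i)=\inf\{n>i: y(i,n)\ge0\}$ if this set is nonempty, and $R_x(i)=i$ otherwise. The record graph has vertex set $\mathbb{Z}$ and a directed edge $i\to R_x(i)$ (child to parent) whenever $R_x(i)\ne i$; components are taken in the undirected sense. A Family Tree is a directed tree in which every vertex has out-degree at most one; it is an Eternal Family Tree (EFT) if every vertex has out-degree exactly one. $F$ denotes the parent map and $F^0(\mathbf{o})=\mathbf{o}$. For a distribution $\pi$ on $\{0,1,2,\dots\}$ with mean $1$ and $\pi(1)<1$, with size-biased distribution $\hat\pi(k)=k\pi(k)$, $EGWT(\pi)$ is the random rooted ordered EFT $[\mathbf{T},\mathbf{o}]$ in which: the root and all its descendants reproduce independently with offspring distribution $\pi$; for each $n\ge1$ the ancestor $F^n(\mathbf{o})$ has a $\hat\pi$-distributed number of children (one of which is $F^{n-1}(\mathbf{o})$); the descendants of $F^n(\mathbf{o})$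 that are not descendants of $F^{n-1}(\mathbf{o})$ (and not $F^{n-1}(\mathbf{o})$) reproduce independently with distribution $\pi$; all reproductions are independent; and the order among the children of every vertex is uniform. *)

theory Defs
  imports "HOL-Probability.Probability"
begin

definition rec_y :: "(int \<Rightarrow> int) \<Rightarrow> int \<Rightarrow> int \<Rightarrow> int" where
  "rec_y x j k = (\<Sum>l\<in>{j..<k}. x l)"

text \<open>Record map; R x i = i encodes ``no parent''.\<close>
definition record_map :: "(int \<Rightarrow> int) \<Rightarrow> int \<Rightarrow> int" where
  "record_map x i =
     (if \<exists>n>i. rec_y x i n \<ge> 0 then (LEAST n. i < n \<and> 0 \<le> rec_y x i n) else i)"

definition record_edges :: "(int \<Rightarrow> int) \<Rightarrow> (int \<times> int) set" where
  "record_edges x = {(i, record_map x i) | i. record_map x i \<noteq> i}"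

definition record_component :: "(int \<Rightarrow> int) \<Rightarrow> int \<Rightarrow> int set" where
  "record_component x i = {j. (i, j) \<in> (record_edges x \<union> (record_edges x)\<inverse>)\<^sup>*}"

text \<open>A family tree with vertex set V, parent map F (F v = v meaning v has no parent),
  children ordered by the linear order of the vertex type.  The rooted ordered tree
  [T, r] is encoded (up to isomorphism) by: for each n, the position of F^n(r) among the
  children of F^(n+1)(r), and the set of Ulam-Harris addresses of the descendant tree
  of F^n(r).\<close>

definition ft_children :: "'a set \<Rightarrow> ('a \<Rightarrow> 'a) \<Rightarrow> 'a \<Rightarrow> 'a::linorder list" where
  "ft_children V F v = sorted_list_of_set {u \<in> V. F u = v \<and> u \<noteq> v}"

fun ft_addr_ok :: "'a::linorder set \<Rightarrow> ('a \<Rightarrow> 'a) \<Rightarrow> 'a \<Rightarrow> nat list \<Rightarrow> bool" where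
  "ft_addr_ok V F v [] = True"
| "ft_addr_ok V F v (i # w) =
     (i < length (ft_children V F v) \<and> ft_addr_ok V F (ft_children V F v ! i) w)"

definition ft_pos :: "'a::linorder set \<Rightarrow> ('a \<Rightarrow> 'a) \<Rightarrow> 'a \<Rightarrow> nat" where
  "ft_pos V F v =
     (LEAST i. i < length (ft_children V F (F v)) \<and> ft_children V F (F v) ! i = v)"

definition ft_code :: "'a::linorder set \<Rightarrow> ('a \<Rightarrow> 'a) \<Rightarrow> 'a
                      \<Rightarrow> (nat \<Rightarrow> nat) \<times> (nat \<Rightarrow> nat list \<Rightarrow> bool)" where
  "ft_code V F r = (\<lambda>n. ft_pos V F ((F ^^ n) r), \<lambda>n w. ft_addr_ok V F ((F ^^ n) r) w)"

definition tree_space :: "((nat \<Rightarrow> nat) \<times> (nat \<Rightarrow> nat list \<Rightarrow> bool)) measure" where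
  "tree_space =
     PiM UNIV (\<lambda>_::nat. count_space (UNIV::nat set)) \<Otimes>\<^sub>M
     PiM UNIV (\<lambda>_::nat. PiM UNIV (\<lambda>_::nat list. count_space (UNIV::bool set)))"

definition record_code :: "(int \<Rightarrow> int) \<Rightarrow> (nat \<Rightarrow> nat) \<times> (nat \<Rightarrow> nat list \<Rightarrow> bool)" where
  "record_code x = ft_code (record_component x 0) (record_map x) 0"

definition size_bias_pmf :: "nat pmf \<Rightarrow> nat pmf" where
  "size_bias_pmf p = embed_pmf (\<lambda>k. real k * pmf p k)"

text \<open>(number of children of a spine vertex, uniform position of the previous spine vertex)\<close>
definition spine_pmf :: "nat pmf \<Rightarrow> (nat \<times> nat) pmf" where
  "spine_pmf p = bind_pmf (size_bias_pmf p) (\<lambda>k. map_pmf (\<lambda>j. (k, j)) (pmf_of_set {..<k}))"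

inductive_set gw_tree :: "(nat list \<Rightarrow> nat) \<Rightarrow> nat list set" for f where
  gw_root: "[] \<in> gw_tree f"
| gw_child: "u \<in> gw_tree f \<Longrightarrow> i < f u \<Longrightarrow> u @ [i] \<in> gw_tree f"

type_synonym egwt_src = "(nat \<Rightarrow> nat \<times> nat) \<times> (nat \<times> nat list \<Rightarrow> nat)"

text \<open>fst w n = (children count, position of F^n(o)) of F^(n+1)(o);
  snd w (n, u) = offspring number of the vertex with address u in the descendant
  tree of F^n(o) (only used for vertices not descending from F^(n-1)(o)).\<close>
fun egwt_D :: "egwt_src \<Rightarrow> nat \<Rightarrow> nat list set" where
  "egwt_D w 0 = gw_tree (\<lambda>u. snd w (0, u))"
| "egwt_D w (Suc n) =
     {[]} \<union> (\<lambda>u. snd (fst w n) # u) ` egwt_D w n \<union>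
     {i # u | i u. i < fst (fst w n) \<and> i \<noteq> snd (fst w n) \<and>
                   u \<in> gw_tree (\<lambda>v. snd w (Suc n, i # v))}"

definition egwt_code :: "egwt_src \<Rightarrow> (nat \<Rightarrow> nat) \<times> (nat \<Rightarrow> nat list \<Rightarrow> bool)" where
  "egwt_code w = (\<lambda>n. snd (fst w n), \<lambda>n u. u \<in> egwt_D w n)"

definition egwt_source :: "nat pmf \<Rightarrow> egwt_src measure" where
  "egwt_source p =
     PiM UNIV (\<lambda>_::nat. measure_pmf (spine_pmf p)) \<Otimes>\<^sub>M
     PiM UNIV (\<lambda>_::nat \<times> nat list. measure_pmf p)"

definition EGWT :: "nat pmf \<Rightarrow> ((nat \<Rightarrow> nat) \<times> (nat \<Rightarrow> nat list \<Rightarrow> bool)) measure" where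
  "EGWT p = distr (egwt_source p) tree_space egwt_code"

end

(* A vertex v of the record graph has x (v-1) + 1 children, and its descendant tree is a finite
   plane tree T exactly when the values of x just before v spell out, in postorder, the degrees of T
   minus 1 (the Lukasiewicz path of T).  Hence prescribing the first n positions on the ancestral
   line and the descendant tree of F^n(o) amounts to prescribing finitely many values of x, and this
   has probability prod pi(deg v) over the vertices v of the tree.  In EGWT(pi) the same event has the
   same probability, because the uniform position of a child cancels the size bias on the spine:
   k pi(k) / k = pi(k).  Finally these weights sum to 1 over all trees of generation n: the
   extinction probability of the critical offspring law pi is 1, and its mean is 1.  So the two laws
   agree on all events that depend on finitely many generations. *)
theory Submission
  imports Defs
begin

text \<open>The record map points to the right, so a finite descendant tree of \<open>v\<close>
  fills a block of integers that ends at \<open>v\<close>, and the blocks of siblings follow one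
  another in the order of the integers. This is why the traversal is postorder: a child block
  precedes its parent. Passing from an ancestor to the next one extends the block at both ends: to
  the left by the subtrees of the smaller siblings, to the right by those of the larger siblings and
  by the new ancestor itself. So n generations are described by a finite tree \<open>t\<close> and a
  list \<open>zs\<close> of n pairs (left subtrees, right subtrees), and the corresponding event is
  a word in one finite window around 0. The weight is multiplicative under this extension. The sum
  over all \<open>(t, zs)\<close> therefore factors into the total weight of finite trees, which is
  the extinction probability, and n copies of the total weight of one pair. Once trees have total
  weight 1, a pair with a left and b right subtrees contributes pi(a + 1 + b) in total, and each k =
  a + 1 + b arises from k pairs (a, b); this is where the mean enters.\<close>

datatype plane_tree = Node (kids: "plane_tree list")

instance plane_tree :: countable
  by countable_datatype

primrec postorder :: "plane_tree \<Rightarrow> nat list" where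
  "postorder (Node ts) = concat (map postorder ts) @ [length ts]"

fun address :: "plane_tree \<Rightarrow> nat list \<Rightarrow> bool" where
  "address t [] = True"
| "address t (i # u) = (i < length (kids t) \<and> address (kids t ! i) u)"

section \<open>Words read in the sequence, partial sums and the record map\<close>

definition reads :: "(int \<Rightarrow> int) \<Rightarrow> int \<Rightarrow> nat list \<Rightarrow> bool" where
  "reads x a ds \<longleftrightarrow> (\<forall>i<length ds. x (a + int i) = int (ds ! i) - 1)"

lemma reads_Nil [simp]: "reads x a []"
  by (simp add: reads_def)

lemma reads_Cons [simp]: "reads x a (d # ds) \<longleftrightarrow> x a = int d - 1 \<and> reads x (a + 1) ds"
proof -
  have "(\<forall>i<Suc n. Q i) \<longleftrightarrow> Q 0 \<and> (\<forall>i<n. Q (Suc i))" for n and Q :: "nat \<Rightarrow> bool"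
    by (metis Suc_less_eq not0_implies_Suc zero_less_Suc)
  then show ?thesis
    unfolding reads_def by (simp add: add.assoc)
qed

lemma reads_append [simp]:
  "reads x a (ds @ es) \<longleftrightarrow> reads x a ds \<and> reads x (a + int (length ds)) es"
  by (induction ds arbitrary: a) (auto simp: add.assoc)

lemma rec_y_add:
  assumes "i \<le> j" "j \<le> k"
  shows "rec_y x i k = rec_y x i j + rec_y x j k"
proof -
  have "{i..<k} = {i..<j} \<union> {j..<k}" using assms by auto
  then show ?thesis
    unfolding rec_y_def by (simp add: sum.union_disjoint)
qed

lemma rec_y_Suc: "i \<le> j \<Longrightarrow> rec_y x i (j + 1) = rec_y x i j + x j"
proof -
  assume "i \<le> j"
  moreover have "{j..<j + 1} = {j}" by auto
  ultimately show ?thesis using rec_y_add[of i j "j + 1" x] by (simp add: rec_y_def)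
qed

lemma rec_y_same [simp]: "rec_y x i i = 0"
  by (simp add: rec_y_def)

lemma record_map_eqI:
  assumes "i < n" "0 \<le> rec_y x i n" "\<And>m. i < m \<Longrightarrow> m < n \<Longrightarrow> rec_y x i m < 0"
  shows "record_map x i = n"
proof -
  have "(LEAST n. i < n \<and> 0 \<le> rec_y x i n) = n"
    by (rule Least_equality) (use assms in \<open>auto simp: not_le[symmetric]\<close>)
  then show ?thesis using assms by (auto simp: record_map_def)
qed

lemma record_map_cases:
  obtains "record_map x i = i" "\<And>n. i < n \<Longrightarrow> rec_y x i n < 0"
  | "i < record_map x i" "0 \<le> rec_y x i (record_map x i)"
    "\<And>m. i < m \<Longrightarrow> m < record_map x i \<Longrightarrow> rec_y x i m < 0"
proof (cases "\<exists>n>i. 0 \<le> rec_y x i n")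
  case True
  then obtain n where n: "i < n" "0 \<le> rec_y x i n" by blast
  \<comment> \<open>The integers are not well-ordered, so the first nonnegative partial sum is
    located by its natural distance from \<open>i\<close>.\<close>
  define P where "P k \<longleftrightarrow> 0 < k \<and> 0 \<le> rec_y x i (i + int k)" for k
  have "P (nat (n - i))" using n by (simp add: P_def)
  then have P: "P (LEAST k. P k)" by (rule LeastI)
  have "rec_y x i m < 0" if "i < m" "m < i + int (LEAST k. P k)" for m
  proof -
    have "nat (m - i) < (LEAST k. P k)" using that by linarith
    then have "\<not> P (nat (m - i))" by (rule not_less_Least)
    then show ?thesis using that by (simp add: P_def)
  qed
  moreover from this have "record_map x i = i + int (LEAST k. P k)"
    using P by (intro record_map_eqI) (auto simp: P_def)
  ultimately show ?thesis using P by (intro that(2)) (auto simp: P_def)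
next
  case False
  then show ?thesis by (intro that(1)) (auto simp: record_map_def not_le)
qed

text \<open>Trades \<open>LEAST\<close> for countably many conditions on finite partial sums, the
  form from which measurability is read off later. The second alternative is the convention for a
  vertex without parent.\<close>

lemma record_map_eq_iff:
  "record_map x i = n \<longleftrightarrow>
     (i < n \<and> 0 \<le> rec_y x i n \<and> (\<forall>m. i < m \<longrightarrow> m < n \<longrightarrow> rec_y x i m < 0)) \<or>
     (n = i \<and> (\<forall>m. i < m \<longrightarrow> rec_y x i m < 0))"
  by (cases rule: record_map_cases[of x i])
     (auto intro: record_map_eqI, (smt (verit))+)

lemma record_map_le:
  assumes "i < n" "0 \<le> rec_y x i n"
  shows "record_map x i \<le> n"
  by (cases rule: record_map_cases[of x i]) (use assms in \<open>auto simp: not_le[symmetric]\<close>)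

section \<open>Lukasiewicz paths and the children of a vertex\<close>

lemma reads_forest:
  assumes "\<And>t a. t \<in> set ts \<Longrightarrow> reads x a (postorder t) \<Longrightarrow>
             rec_y x a (a + int (length (postorder t))) = -1 \<and>
             (\<forall>m. a < m \<longrightarrow> m \<le> a + int (length (postorder t)) \<longrightarrow> rec_y x a m < 0)"
    and "reads x a (concat (map postorder ts))"
  shows "rec_y x a (a + int (length (concat (map postorder ts)))) = - int (length ts) \<and>
         (\<forall>m. a < m \<longrightarrow> m \<le> a + int (length (concat (map postorder ts))) \<longrightarrow> rec_y x a m < 0)"
  using assms
\<comment> \<open>The claim for single trees is a hypothesis because \<open>reads_tree\<close>, by
  structural induction, can supply it only for subtrees. Each tree lowers the walk by 1, and the
  excursion inside the next tree starts from that lower level.\<close>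
proof (induction ts arbitrary: a)
  case Nil
  then show ?case by simp
next
  case (Cons t ts)
  define b where "b = a + int (length (postorder t))"
  define c where "c = b + int (length (concat (map postorder ts)))"
  have t: "rec_y x a b = -1" "\<And>m. a < m \<Longrightarrow> m \<le> b \<Longrightarrow> rec_y x a m < 0"
    using Cons.prems(1)[of t a] Cons.prems(2) by (auto simp: b_def)
  have ts: "rec_y x b c = - int (length ts)" "\<And>m. b < m \<Longrightarrow> m \<le> c \<Longrightarrow> rec_y x b m < 0"
    using Cons.IH[of b] Cons.prems by (auto simp: b_def c_def)
  have le: "a \<le> b" "b \<le> c" by (auto simp: b_def c_def)
  have "rec_y x a c = - int (length (t # ts))"
    using t ts rec_y_add[OF le, of x] by simp
  moreover have "rec_y x a m < 0" if "a < m" "m \<le> c" for m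
  proof (cases "m \<le> b")
    case True
    then show ?thesis using t that by auto
  next
    case False
    then show ?thesis using t(1) ts(2)[of m] that le rec_y_add[of a b m x] by simp
  qed
  moreover have "c = a + int (length (concat (map postorder (t # ts))))"
    by (simp add: b_def c_def)
  ultimately show ?case by blast
qed

text \<open>Postorder form of the Lukasiewicz path: while a tree is read, the walk stays strictly
  below its starting level, and it ends one level below it.\<close>

lemma reads_tree:
  assumes "reads x a (postorder t)"
  shows "rec_y x a (a + int (length (postorder t))) = -1 \<and>
         (\<forall>m. a < m \<longrightarrow> m \<le> a + int (length (postorder t)) \<longrightarrow> rec_y x a m < 0)"
  using assms
proof (induction t arbitrary: a)
  case (Node ts)
  define b where "b = a + int (length (concat (map postorder ts)))"
  have len: "a + int (length (postorder (Node ts))) = b + 1" by (simp add: b_def)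
  have ab: "a \<le> b" by (simp add: b_def)
  have f: "rec_y x a b = - int (length ts)" "\<And>m. a < m \<Longrightarrow> m \<le> b \<Longrightarrow> rec_y x a m < 0"
    using reads_forest[of ts x a] Node by (auto simp: b_def)
  \<comment> \<open>The letter of the root, \<open>length ts - 1\<close>, lifts the walk from
    \<open>- length ts\<close> to -1.\<close>
  have "rec_y x a (b + 1) = -1"
    using f(1) Node.prems rec_y_Suc[OF ab, of x] by (simp add: b_def)
  moreover from this have "rec_y x a m < 0" if "a < m" "m \<le> b + 1" for m
    using f(2)[of m] that by (cases "m = b + 1") auto
  ultimately show ?case unfolding len by blast
qed

text \<open>A tree whose word occupies [a, v) has its root at the right end v, which lies outside
  the word: the degree of v is stored in the letter at v - 1.\<close>

primrec roots :: "int \<Rightarrow> plane_tree list \<Rightarrow> int list" where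
  "roots a [] = []"
| "roots a (t # ts) = (a + int (length (postorder t))) # roots (a + int (length (postorder t))) ts"

lemma length_postorder_pos: "0 < length (postorder t)"
  by (cases t) auto

lemma length_roots [simp]: "length (roots a ts) = length ts"
  by (induction ts arbitrary: a) auto

lemma roots_append: 
  "roots a (ts @ us) = roots a ts @ roots (a + int (length (concat (map postorder ts)))) us"
  by (induction ts arbitrary: a) (auto simp: add.assoc)

lemma roots_greater: "u \<in> set (roots a ts) \<Longrightarrow> a < u"
proof (induction ts arbitrary: a)
  case (Cons t ts)
  then show ?case using length_postorder_pos[of t] by fastforce
qed simp

lemma roots_le: "u \<in> set (roots a ts) \<Longrightarrow> u \<le> a + int (length (concat (map postorder ts)))"
  by (induction ts arbitrary: a) (fastforce simp: add.assoc)+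

lemma sorted_roots: "sorted_wrt (<) (roots a ts)"
  by (induction ts arbitrary: a) (auto dest: roots_greater)

lemma roots_nth:
  assumes "i < length ts" "reads x a (concat (map postorder ts))"
  obtains a' where "reads x a' (postorder (ts ! i))"
    "roots a ts ! i = a' + int (length (postorder (ts ! i)))"
proof -
  have "\<exists>a'. reads x a' (postorder (ts ! i)) \<and>
          roots a ts ! i = a' + int (length (postorder (ts ! i)))"
    using assms
  proof (induction ts arbitrary: a i)
    case (Cons t ts)
    then show ?case by (cases i) auto
  qed simp
  then show ?thesis using that by blast
qed

text \<open>From a vertex strictly inside the first tree the sum up to its root \<open>c\<close> is
  nonnegative, so the record comes too early. From \<open>c\<close> the walk stays negative up to
  \<open>b\<close> and the letter \<open>x b\<close> brings it back to at least 0. The bound on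
  \<open>x b\<close> is an inequality so that it survives removal of the first tree.\<close>

lemma record_map_forest:
  assumes "reads x a (concat (map postorder ts))"
    and "b = a + int (length (concat (map postorder ts)))"
    and "int (length ts) \<le> x b + 1" "a < u" "u \<le> b"
  shows "record_map x u = b + 1 \<longleftrightarrow> u \<in> set (roots a ts)"
  using assms
proof (induction ts arbitrary: a)
  case Nil
  then show ?case by simp
next
  case (Cons t ts)
  define c where "c = a + int (length (postorder t))"
  have b: "b = c + int (length (concat (map postorder ts)))"
    using Cons.prems(2) by (simp add: c_def)
  have t: "rec_y x a c = -1" "\<And>m. a < m \<Longrightarrow> m \<le> c \<Longrightarrow> rec_y x a m < 0"
    using reads_tree[of x a t] Cons.prems(1) by (auto simp: c_def)
  have ts: "rec_y x c b = - int (length ts)" "\<And>m. c < m \<Longrightarrow> m \<le> b \<Longrightarrow> rec_y x c m < 0"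
    using reads_forest[of ts x c] Cons.prems(1) reads_tree by (auto simp: c_def b)
  have cb: "c \<le> b" by (simp add: b)
  consider "u < c" | "u = c" | "c < u" by linarith
  then show ?case
  proof cases
    case 1
    have "0 \<le> rec_y x u c"
      using rec_y_add[of a u c x] t(1) t(2)[of u] 1 Cons.prems by simp
    then have "record_map x u \<le> c" using 1 by (rule record_map_le[rotated])
    moreover have "u \<notin> set (roots a (t # ts))"
      using 1 roots_greater[of u c ts] by (auto simp: c_def)
    ultimately show ?thesis using cb by simp
  next
    case 2
    have "record_map x u = b + 1"
      using 2 cb ts rec_y_Suc[OF cb, of x] Cons.prems(3)
      by (intro record_map_eqI) auto
    then show ?thesis using 2 by (simp add: c_def)
  next
    case 3
    have "record_map x u = b + 1 \<longleftrightarrow> u \<in> set (roots c ts)"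
    proof (rule Cons.IH)
      show "reads x c (concat (map postorder ts))" using Cons.prems(1) by (simp add: c_def)
    qed (use Cons.prems 3 b in auto)
    then show ?thesis using 3 by (simp add: c_def)
  qed
qed

text \<open>No child lies at or to the left of \<open>a\<close>: its walk would be at most 0 on
  arrival at \<open>a\<close>, and the block of \<open>v\<close> lowers it by 1 more. Inside the
  block \<open>record_map_forest\<close> decides.\<close>

lemma record_children:
  assumes "reads x a (postorder (Node ts))"
    and "v = a + int (length (postorder (Node ts)))"
  shows "{u. record_map x u = v \<and> u \<noteq> v} = set (roots a ts)"
proof -
  define b where "b = a + int (length (concat (map postorder ts)))"
  have v: "v = b + 1" and xb: "x b = int (length ts) - 1"
    using assms by (auto simp: b_def)
  have av: "rec_y x a v = -1" "\<And>m. a < m \<Longrightarrow> m \<le> v \<Longrightarrow> rec_y x a m < 0"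
    using reads_tree[OF assms(1)] assms(2) by auto
  have ab: "a < v" by (simp add: v b_def)
  have range: "a < u \<and> u \<le> b" if "record_map x u = v" "u \<noteq> v" for u
  proof -
    have u: "u < v" "0 \<le> rec_y x u v" "\<And>m. u < m \<Longrightarrow> m < v \<Longrightarrow> rec_y x u m < 0"
      using that by (auto simp: record_map_eq_iff)
    have "\<not> u \<le> a"
    proof
      assume "u \<le> a"
      then have "rec_y x u v = rec_y x u a - 1" 
        using rec_y_add[of u a v x] av(1) ab by simp
      moreover have "rec_y x u a \<le> 0"
        using u(3)[of a] \<open>u \<le> a\<close> ab by (cases "u = a") auto
      ultimately show False using u(2) by simp
    qed
    then show ?thesis using u(1) v by simp
  qed
  have "record_map x u = v \<longleftrightarrow> u \<in> set (roots a ts)" if "a < u" "u \<le> b" for u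
    using record_map_forest[of x a ts b u] assms(1) xb that by (simp add: b_def v)
  moreover have "a < u \<and> u \<le> b" if "u \<in> set (roots a ts)" for u
    using that roots_greater roots_le by (auto simp: b_def)
  ultimately show ?thesis using range v by force
qed

section \<open>The component of 0 and the descendant trees in it\<close>

lemma record_component_refl: "i \<in> record_component x i"
  by (simp add: record_component_def)

lemma record_component_step:
  assumes "record_map x u = v" "u \<noteq> v"
  shows "u \<in> record_component x i \<longleftrightarrow> v \<in> record_component x i"
proof -
  have "(u, v) \<in> record_edges x" using assms by (auto simp: record_edges_def)
  then show ?thesis
    unfolding record_component_def
    by (auto intro: rtrancl_into_rtrancl)
qed

text \<open>The component is closed under edges in both directions, so restricting to it loses no
  child, and \<open>roots\<close> already lists the children in increasing order.\<close>

lemma ft_children_record: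
  assumes "reads x a (postorder (Node ts))"
    and "v = a + int (length (postorder (Node ts)))"
    and "v \<in> record_component x 0"
  shows "ft_children (record_component x 0) (record_map x) v = roots a ts"
proof -
  have "{u \<in> record_component x 0. record_map x u = v \<and> u \<noteq> v} = {u. record_map x u = v \<and> u \<noteq> v}"
    using assms(3) record_component_step by blast
  also have "\<dots> = set (roots a ts)" using assms(1,2) by (rule record_children)
  finally show ?thesis
    unfolding ft_children_def using sorted_roots[of a ts]
    by (simp add: strict_sorted_iff sorted_list_of_set.idem_if_sorted_distinct)
qed

lemma ft_addr_ok_record:
  assumes "reads x a (postorder t)"
    and "v = a + int (length (postorder t))"
    and "v \<in> record_component x 0"
  shows "ft_addr_ok (record_component x 0) (record_map x) v u \<longleftrightarrow> address t u"
  using assms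
proof (induction u arbitrary: t a v)
  case Nil
  then show ?case by simp
next
  case (Cons i u)
  obtain ts where t: "t = Node ts" by (cases t)
  have ch: "ft_children (record_component x 0) (record_map x) v = roots a ts"
    using Cons.prems ft_children_record unfolding t by blast
  have "ft_addr_ok (record_component x 0) (record_map x) (roots a ts ! i) u \<longleftrightarrow> address (ts ! i) u"
    if i: "i < length ts"
  proof -
    have "reads x a (concat (map postorder ts))" using Cons.prems t by simp
    with i obtain a' where a': "reads x a' (postorder (ts ! i))"
      "roots a ts ! i = a' + int (length (postorder (ts ! i)))"
      by (rule roots_nth)
    have "roots a ts ! i \<in> set (roots a ts)" using i by simp
    then have "record_map x (roots a ts ! i) = v \<and> roots a ts ! i \<noteq> v"
      using record_children[of x a ts v] Cons.prems t by blast
    then have "roots a ts ! i \<in> record_component x 0"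
      using record_component_step Cons.prems(3) by blast
    then show ?thesis using Cons.IH a' by blast
  qed
  then show ?case by (auto simp: ch t)
qed

section \<open>The ancestral line in the record graph\<close>

fun graft :: "plane_tree list \<times> plane_tree list \<Rightarrow> plane_tree \<Rightarrow> plane_tree" where
  "graft (ls, rs) t = Node (ls @ t # rs)"

text \<open>A code is determined up to generation \<open>n\<close> by the descendant tree \<open>t\<close> of the root and, for
  \<open>k < n\<close>, by the subtrees hanging to the left and to the right of the \<open>k\<close>-th spine vertex.\<close>

definition code_agrees ::
  "plane_tree \<Rightarrow> (plane_tree list \<times> plane_tree list) list \<Rightarrow>
     (nat \<Rightarrow> nat) \<times> (nat \<Rightarrow> nat list \<Rightarrow> bool) \<Rightarrow> bool" where
  "code_agrees t zs c \<longleftrightarrow>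
     (\<forall>k<length zs. fst c k = length (fst (zs ! k))) \<and>
     (\<forall>k\<le>length zs. \<forall>u. snd c k u \<longleftrightarrow> address (fold graft (take k zs) t) u)"

text \<open>In postorder the left branches of the spine precede \<open>t\<close>, while the right
  branches and the ancestors follow it. Hence only left branches move the start of the window
  relative to the root of \<open>t\<close>.\<close>

definition left_size :: "(plane_tree list \<times> plane_tree list) list \<Rightarrow> nat" where
  "left_size zs = (\<Sum>(ls, rs)\<leftarrow>zs. length (concat (map postorder ls)))"

lemma left_size_simps [simp]:
  "left_size [] = 0"
  "left_size ((ls, rs) # zs) = length (concat (map postorder ls)) + left_size zs"
  by (auto simp: left_size_def)

text \<open>The word of a child is a factor of the word of its parent. The parent of
  \<open>v\<close> sits at \<open>v'\<close>: the blocks of the right siblings follow directly after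
  \<open>v\<close>, and one more step closes the tree.\<close>

lemma reads_graft:
  assumes "reads x (v - int (length (postorder t)) - int (left_size zs)) (postorder (fold graft zs t))"
  shows "reads x (v - int (length (postorder t))) (postorder t)"
  using assms
proof (induction zs arbitrary: t v)
  case (Cons z zs)
  obtain ls rs where z: "z = (ls, rs)" by (cases z)
  define v' where "v' = v + int (length (concat (map postorder rs))) + 1"
  have "v - int (length (postorder t)) - int (left_size (z # zs)) =
      v' - int (length (postorder (graft z t))) - int (left_size zs)"
    by (simp add: v'_def z)
  then have "reads x (v' - int (length (postorder (graft z t)))) (postorder (graft z t))"
    using Cons by simp
  then have "reads x (v' - int (length (postorder (graft z t))) + int (length (concat (map postorder ls))))
      (postorder t)"
    by (simp add: z)
  moreover have "v' - int (length (postorder (graft z t))) + int (length (concat (map postorder ls))) =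
      v - int (length (postorder t))"
    by (simp add: v'_def z)
  ultimately show ?case by simp
qed simp

lemma ft_pos_record:
  assumes "reads x a (postorder (Node (ls @ t # rs)))"
    and "w = a + int (length (postorder (Node (ls @ t # rs))))"
    and "v = a + int (length (concat (map postorder ls))) + int (length (postorder t))"
    and "v \<in> record_component x 0"
  shows "record_map x v = w" "w \<in> record_component x 0"
    "ft_pos (record_component x 0) (record_map x) v = length ls"
proof -
  let ?r = "roots a (ls @ t # rs)"
  have nth: "?r ! length ls = v"
    using assms(3) by (simp add: roots_append nth_append)
  have "length ls < length ?r" by simp
  then have "v \<in> set ?r" using nth nth_mem by metis
  then have v: "record_map x v = w" "v \<noteq> w"
    using record_children[OF assms(1,2)] by blast+
  then show "record_map x v = w" by simp
  show w: "w \<in> record_component x 0"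
    using v assms(4) record_component_step by blast
  have ch: "ft_children (record_component x 0) (record_map x) w = ?r"
    using assms(1,2) w by (rule ft_children_record)
  have "distinct ?r" using sorted_roots by (simp add: strict_sorted_iff)
  then have "i = length ls" if "i < length ?r" "?r ! i = v" for i
    using that nth \<open>length ls < length ?r\<close> nth_eq_iff_index_eq by metis
  then show "ft_pos (record_component x 0) (record_map x) v = length ls"
    unfolding ft_pos_def v(1) ch using nth \<open>length ls < length ?r\<close>
    by (intro Least_equality) auto
qed

text \<open>The induction replaces \<open>v\<close> by its parent \<open>v'\<close> and absorbs the
  first pair into the tree. The equation \<open>eq\<close> says that this leaves the start of the
  window fixed.\<close>

lemma record_spine:
  assumes "reads x (v - int (length (postorder t)) - int (left_size zs)) (postorder (fold graft zs t))"
    and "v \<in> record_component x 0"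
  shows "(\<forall>k<length zs. ft_pos (record_component x 0) (record_map x) ((record_map x ^^ k) v) =
            length (fst (zs ! k))) \<and>
         (\<forall>k\<le>length zs. \<forall>u. ft_addr_ok (record_component x 0) (record_map x) ((record_map x ^^ k) v) u
            \<longleftrightarrow> address (fold graft (take k zs) t) u)"
  using assms
proof (induction zs arbitrary: t v)
  case Nil
  then show ?case using ft_addr_ok_record[of x "v - int (length (postorder t))" t v] by simp
next
  case (Cons z zs)
  obtain ls rs where z: "z = (ls, rs)" by (cases z)
  define v' where "v' = v + int (length (concat (map postorder rs))) + 1"
  define a where "a = v' - int (length (postorder (Node (ls @ t # rs))))"
  have eq: "v - int (length (postorder t)) - int (left_size (z # zs)) =
      v' - int (length (postorder (graft z t))) - int (left_size zs)"
    by (simp add: v'_def z)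
  have reads: "reads x (v' - int (length (postorder (graft z t))) - int (left_size zs))
      (postorder (fold graft zs (graft z t)))"
    using Cons.prems(1) unfolding eq by simp
  have tree: "reads x a (postorder (Node (ls @ t # rs)))"
    using reads_graft[OF reads] by (simp add: a_def z)
  have v'_eq: "v' = a + int (length (postorder (Node (ls @ t # rs))))"
    by (simp add: a_def)
  have v_eq: "v = a + int (length (concat (map postorder ls))) + int (length (postorder t))"
    by (simp add: a_def v'_def)
  note pos = ft_pos_record[OF tree v'_eq v_eq Cons.prems(2)]
  have v: "ft_addr_ok (record_component x 0) (record_map x) v u \<longleftrightarrow> address t u" for u
    using ft_addr_ok_record[OF reads_graft[OF Cons.prems(1)] _ Cons.prems(2)] by simp
  have IH: "(\<forall>k<length zs. ft_pos (record_component x 0) (record_map x) ((record_map x ^^ k) v') =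
            length (fst (zs ! k))) \<and>
         (\<forall>k\<le>length zs. \<forall>u. ft_addr_ok (record_component x 0) (record_map x) ((record_map x ^^ k) v') u
            \<longleftrightarrow> address (fold graft (take k zs) (graft z t)) u)"
    using Cons.IH[OF reads pos(2)] .
  have step: "(record_map x ^^ Suc k) v = (record_map x ^^ k) v'" for k
    by (simp only: funpow_Suc_right o_apply pos(1))
  show ?case
  proof (intro conjI allI impI)
    fix k assume "k < length (z # zs)"
    then show "ft_pos (record_component x 0) (record_map x) ((record_map x ^^ k) v) =
        length (fst ((z # zs) ! k))"
      using IH pos(3) by (cases k) (auto simp: step z simp del: funpow.simps(2))
  next
    fix k u assume "k \<le> length (z # zs)"
    then show "ft_addr_ok (record_component x 0) (record_map x) ((record_map x ^^ k) v) u =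
        address (fold graft (take k (z # zs)) t) u"
      using IH v by (cases k) (auto simp: step simp del: funpow.simps(2))
  qed
qed

lemma record_code_agrees:
  assumes "reads x (- int (length (postorder t)) - int (left_size zs)) (postorder (fold graft zs t))"
  shows "code_agrees t zs (record_code x)"
  using record_spine[of x 0 t zs] assms record_component_refl
  by (simp add: code_agrees_def record_code_def ft_code_def)

section \<open>Recovering trees from codes\<close>

lemma address_inject:
  assumes "\<And>u. address s u \<longleftrightarrow> address t u"
  shows "s = t"
  using assms
proof (induction s arbitrary: t)
  case (Node ss)
  obtain ts where t: "t = Node ts" by (cases t)
  have "i < length ss \<longleftrightarrow> i < length ts" for i
    using Node.prems[of "[i]"] by (simp add: t)
  then have len: "length ss = length ts" by (meson linorder_neqE_nat less_irrefl)
  moreover have "ss ! i = ts ! i" if i: "i < length ss" for i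
  proof (rule Node.IH)
    show "ss ! i \<in> set ss" using i by simp
    show "address (ss ! i) u \<longleftrightarrow> address (ts ! i) u" for u
      using Node.prems[of "i # u"] i len by (simp add: t)
  qed
  ultimately show ?case by (auto simp: t intro: nth_equalityI)
qed

text \<open>The tree of the next generation gives the list of children, and the recorded position
  says where to cut it into left and right siblings. This makes the cylinders of one generation
  disjoint.\<close>

lemma code_agrees_inject:
  assumes "code_agrees s ys c" "code_agrees t zs c" "length ys = length zs"
  shows "s = t \<and> ys = zs"
proof -
  have tree: "fold graft (take k ys) s = fold graft (take k zs) t" if "k \<le> length zs" for k
    using assms that by (intro address_inject) (auto simp: code_agrees_def)
  have "ys ! k = zs ! k" if k: "k < length zs" for k
  proof -
    obtain ls rs ls' rs' where eq: "ys ! k = (ls, rs)" "zs ! k = (ls', rs')" by fastforce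
    have "length ls = length ls'" using assms k eq by (auto simp: code_agrees_def)
    moreover have "graft (ys ! k) (fold graft (take k ys) s) = graft (zs ! k) (fold graft (take k zs) t)"
      using tree[of "Suc k"] k assms(3) by (simp add: take_Suc_conv_app_nth)
    ultimately show ?thesis by (simp add: eq)
  qed
  with assms(3) tree[of 0] show ?thesis by (auto intro: nth_equalityI)
qed

section \<open>Finite constraints on the source of the EGWT\<close>

definition sat :: "('i \<Rightarrow> nat) \<Rightarrow> ('i \<times> nat) list \<Rightarrow> bool" where
  "sat f cs \<longleftrightarrow> (\<forall>(i, d)\<in>set cs. f i = d)"

lemma sat_simps [simp]:
  "sat f []"
  "sat f ((i, d) # cs) \<longleftrightarrow> f i = d \<and> sat f cs"
  "sat f (cs @ ds) \<longleftrightarrow> sat f cs \<and> sat f ds"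
  by (auto simp: sat_def ball_Un)

lemma sat_rename: "sat f (map (\<lambda>(u, d). (h u, d)) cs) \<longleftrightarrow> sat (\<lambda>u. f (h u)) cs"
  by (fastforce simp: sat_def)

text \<open>Moves constraints below consecutive children, starting with child number
  \<open>j\<close>; the free start lets \<open>branches\<close> jump over the spine child.\<close>

primrec shift :: "nat \<Rightarrow> (nat list \<times> nat) list list \<Rightarrow> (nat list \<times> nat) list" where
  "shift j [] = []"
| "shift j (cs # css) = map (\<lambda>(u, d). (j # u, d)) cs @ shift (Suc j) css"

primrec degrees :: "plane_tree \<Rightarrow> (nat list \<times> nat) list" where
  "degrees (Node ts) = ([], length ts) # shift 0 (map degrees ts)"

lemma sat_shift: "sat f (shift j css) \<longleftrightarrow> (\<forall>i<length css. sat (\<lambda>u. f ((j + i) # u)) (css ! i))"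
proof (induction css arbitrary: j)
  case (Cons cs css)
  have "(\<forall>i<Suc n. Q i) \<longleftrightarrow> Q 0 \<and> (\<forall>i<n. Q (Suc i))" for n and Q :: "nat \<Rightarrow> bool"
    by (metis Suc_less_eq not0_implies_Suc zero_less_Suc)
  then show ?case by (simp add: Cons sat_rename)
qed simp

text \<open>\<open>gw_tree\<close> grows addresses at their end, whereas plane trees are taken apart
  at the root; this recursion at the front mediates between the two.\<close>

lemma gw_tree_Cons: "i # u \<in> gw_tree f \<longleftrightarrow> i < f [] \<and> u \<in> gw_tree (\<lambda>v. f (i # v))"
proof
  show "i < f [] \<and> u \<in> gw_tree (\<lambda>v. f (i # v))" if "i # u \<in> gw_tree f"
    using that
  proof (induction "i # u" arbitrary: u rule: gw_tree.induct)
    case (gw_child v j)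
    show ?case
    proof (cases v)
      case Nil
      with gw_child show ?thesis by (auto intro: gw_tree.gw_root)
    next
      case (Cons a r)
      with gw_child have "a = i" "u = r @ [j]" by auto
      with gw_child Cons show ?thesis by (auto intro: gw_tree.gw_child)
    qed
  qed
next
  have "i # u \<in> gw_tree f" if "u \<in> gw_tree (\<lambda>v. f (i # v))" "i < f []"
    using that
  proof (induction rule: gw_tree.induct)
    case gw_root
    then show ?case using gw_tree.gw_child[OF gw_tree.gw_root, of i f] by simp
  next
    case (gw_child u j)
    then show ?case using gw_tree.gw_child[of "i # u" f j] by simp
  qed
  then show "i < f [] \<and> u \<in> gw_tree (\<lambda>v. f (i # v)) \<Longrightarrow> i # u \<in> gw_tree f" by blast
qed

lemma gw_tree_address:
  assumes "sat f (degrees t)"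
  shows "u \<in> gw_tree f \<longleftrightarrow> address t u"
  using assms
proof (induction u arbitrary: t f)
  case Nil
  then show ?case by (simp add: gw_tree.gw_root)
next
  case (Cons i u)
  obtain ts where t: "t = Node ts" by (cases t)
  then have f: "f [] = length ts" "\<And>i. i < length ts \<Longrightarrow> sat (\<lambda>v. f (i # v)) (degrees (ts ! i))"
    using Cons.prems by (auto simp: sat_shift)
  then show ?case using Cons.IH by (auto simp: gw_tree_Cons t)
qed

text \<open>Neither the address \<open>[]\<close> nor any address below child
  \<open>length ls\<close> occurs: the degree of an ancestor and the place of its spine child come
  from the spine coordinates, and the subtree of the spine child belongs to earlier levels.\<close>

fun branches :: "plane_tree list \<times> plane_tree list \<Rightarrow> (nat list \<times> nat) list" where
  "branches (ls, rs) = shift 0 (map degrees ls) @ shift (Suc (length ls)) (map degrees rs)"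

primrec levels :: "nat \<Rightarrow> (plane_tree list \<times> plane_tree list) list \<Rightarrow> ((nat \<times> nat list) \<times> nat) list" where
  "levels m [] = []"
| "levels m (z # zs) = map (\<lambda>(u, d). ((m, u), d)) (branches z) @ levels (Suc m) zs"

lemma sat_levels: "sat g (levels m zs) \<longleftrightarrow> (\<forall>k<length zs. sat (\<lambda>u. g (m + k, u)) (branches (zs ! k)))"
proof (induction zs arbitrary: m)
  case (Cons z zs)
  have "(\<forall>i<Suc n. Q i) \<longleftrightarrow> Q 0 \<and> (\<forall>i<n. Q (Suc i))" for n and Q :: "nat \<Rightarrow> bool"
    by (metis Suc_less_eq not0_implies_Suc zero_less_Suc)
  then show ?case by (simp add: Cons sat_rename)
qed simp

fun spine_step :: "plane_tree list \<times> plane_tree list \<Rightarrow> nat \<times> nat" where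
  "spine_step (ls, rs) = (length ls + 1 + length rs, length ls)"

text \<open>Level 0 carries the tree of the root and level \<open>k + 1\<close> the branches at
  \<open>zs ! k\<close>, as in the indexing of \<open>egwt_D\<close>.\<close>

definition egwt_constraints ::
  "plane_tree \<Rightarrow> (plane_tree list \<times> plane_tree list) list \<Rightarrow> ((nat \<times> nat list) \<times> nat) list" where
  "egwt_constraints t zs = map (\<lambda>(u, d). ((0, u), d)) (degrees t) @ levels 1 zs"

lemma egwt_D_address:
  assumes "\<And>k. k < length zs \<Longrightarrow> fst w k = spine_step (zs ! k)"
    and "sat (snd w) (egwt_constraints t zs)" and "k \<le> length zs"
  shows "u \<in> egwt_D w k \<longleftrightarrow> address (fold graft (take k zs) t) u"
  using assms(3)
proof (induction k arbitrary: u)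
  case 0
  then show ?case using assms(2)
    by (simp add: egwt_constraints_def sat_rename gw_tree_address)
next
  case (Suc k)
  obtain ls rs where z: "zs ! k = (ls, rs)" by fastforce
  define T where "T = fold graft (take k zs) t"
  have tree: "fold graft (take (Suc k) zs) t = Node (ls @ T # rs)"
    using Suc.prems by (simp add: take_Suc_conv_app_nth T_def z)
  have w: "fst w k = (length ls + 1 + length rs, length ls)"
    using assms(1)[of k] Suc.prems z by simp
  have br: "sat (\<lambda>u. snd w (Suc k, u)) (branches (zs ! k))"
    using assms(2) Suc.prems by (auto simp: egwt_constraints_def sat_levels)
  then have ls: "sat (\<lambda>v. snd w (Suc k, i # v)) (degrees (ls ! i))" if "i < length ls" for i
    using that by (auto simp: z sat_shift)
  from br have rs: "sat (\<lambda>v. snd w (Suc k, Suc (length ls + i) # v)) (degrees (rs ! i))" if "i < length rs" for i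
    using that by (auto simp: z sat_shift)
  show ?case
  proof (cases u)
    case Nil
    then show ?thesis by simp
  next
    case (Cons i v)
    have D: "u \<in> egwt_D w (Suc k) \<longleftrightarrow>
        (i = length ls \<and> v \<in> egwt_D w k) \<or>
        (i < length ls + 1 + length rs \<and> i \<noteq> length ls \<and> v \<in> gw_tree (\<lambda>v. snd w (Suc k, i # v)))"
      by (auto simp: Cons w)
    \<comment> \<open>Left sibling, spine child, or anything to the right; in the last case an index
      past the right siblings fails on both sides.\<close>
    consider "i < length ls" | "i = length ls" | j where "i = Suc (length ls + j)"
      by (metis less_iff_Suc_add linorder_neqE_nat)
    then show ?thesis
    proof cases
      case 1
      then show ?thesis using gw_tree_address[OF ls[OF 1]]
        by (simp only: D) (simp add: tree Cons nth_append)
    next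
      case 2
      then show ?thesis using Suc by (simp only: D) (simp add: tree Cons nth_append T_def)
    next
      case 3
      show ?thesis
      proof (cases "j < length rs")
        case True
        then show ?thesis using gw_tree_address[OF rs[OF True]] 3
          by (simp only: D) (simp add: tree Cons nth_append)
      next
        case False
        then show ?thesis using 3 by (simp only: D) (simp add: tree Cons)
      qed
    qed
  qed
qed

lemma egwt_code_agrees:
  assumes "\<And>k. k < length zs \<Longrightarrow> fst w k = spine_step (zs ! k)"
    and "sat (snd w) (egwt_constraints t zs)"
  shows "code_agrees t zs (egwt_code w)"
proof -
  have "snd (spine_step z) = length (fst z)" for z by (cases z) simp
  then show ?thesis
    using egwt_D_address[of zs w t] assms by (simp add: code_agrees_def egwt_code_def)
qed

section \<open>Weights of trees and of constraint lists\<close>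

definition weight :: "nat pmf \<Rightarrow> plane_tree \<Rightarrow> real" where
  "weight p t = (\<Prod>d\<leftarrow>postorder t. pmf p d)"

text \<open>The factor by which one graft multiplies the weight, see
  \<open>weight_fold_graft\<close>.\<close>

fun step_weight :: "nat pmf \<Rightarrow> plane_tree list \<times> plane_tree list \<Rightarrow> real" where
  "step_weight p (ls, rs) =
     pmf p (length ls + 1 + length rs) * ((\<Prod>t\<leftarrow>ls. weight p t) * (\<Prod>t\<leftarrow>rs. weight p t))"

lemma prod_list_concat: "prod_list (concat xss) = (\<Prod>xs\<leftarrow>xss. prod_list (xs :: real list))"
  by (induction xss) auto

lemma weight_Node: "weight p (Node ts) = pmf p (length ts) * (\<Prod>t\<leftarrow>ts. weight p t)"
  by (simp add: weight_def[abs_def] map_concat prod_list_concat comp_def)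

lemma weight_nonneg [simp]: "0 \<le> weight p t"
  unfolding weight_def by (rule prod_list_nonneg) auto

lemma weight_fold_graft: "weight p (fold graft zs t) = weight p t * (\<Prod>z\<leftarrow>zs. step_weight p z)"
  by (induction zs arbitrary: t) (auto simp: weight_Node)

lemma map_snd_shift: "map snd (shift j css) = concat (map (map snd) css)"
  by (induction css arbitrary: j) (auto simp: comp_def split_def)

lemma prod_degrees: "(\<Prod>c\<leftarrow>degrees t. pmf p (snd c)) = weight p t"
proof (induction t)
  case (Node ts)
  have "(\<Prod>c\<leftarrow>shift 0 (map degrees ts). pmf p (snd c)) =
      prod_list (map (pmf p) (map snd (shift 0 (map degrees ts))))"
    by (simp add: comp_def)
  also have "\<dots> = (\<Prod>t\<leftarrow>ts. \<Prod>c\<leftarrow>degrees t. pmf p (snd c))"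
    unfolding map_snd_shift by (simp add: map_concat prod_list_concat comp_def)
  also have "\<dots> = (\<Prod>t\<leftarrow>ts. weight p t)"
    using Node by (intro arg_cong[where f = prod_list] map_cong) auto
  finally show ?case by (simp add: weight_Node)
qed

lemma prod_shift: "(\<Prod>c\<leftarrow>shift j (map degrees ts). pmf p (snd c)) = (\<Prod>t\<leftarrow>ts. weight p t)"
proof -
  have "(\<Prod>c\<leftarrow>shift j (map degrees ts). pmf p (snd c)) =
      prod_list (map (pmf p) (map snd (shift j (map degrees ts))))"
    by (simp add: comp_def)
  then show ?thesis
    unfolding map_snd_shift by (simp add: map_concat prod_list_concat comp_def prod_degrees)
qed

text \<open>\<open>levels\<close> contains no degree of an ancestor; the first product supplies
  exactly these factors.\<close>

lemma prod_levels:
  "(\<Prod>z\<leftarrow>zs. pmf p (fst (spine_step z))) * (\<Prod>c\<leftarrow>levels m zs. pmf p (snd c)) =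
     (\<Prod>z\<leftarrow>zs. step_weight p z)"
proof (induction zs arbitrary: m)
  case (Cons z zs)
  obtain ls rs where z: "z = (ls, rs)" by (cases z)
  let ?S = "\<lambda>zs. \<Prod>z\<leftarrow>zs. pmf p (fst (spine_step z))" and ?L = "\<lambda>m zs. \<Prod>c\<leftarrow>levels m zs. pmf p (snd c)"
  have "(\<Prod>c\<leftarrow>map (\<lambda>(u, d). ((m, u), d)) cs. pmf p (snd c)) = (\<Prod>c\<leftarrow>cs. pmf p (snd c))"
    for cs :: "(nat list \<times> nat) list"
    by (simp add: comp_def split_def)
  then have L: "?L m (z # zs) = (\<Prod>t\<leftarrow>ls. weight p t) * (\<Prod>t\<leftarrow>rs. weight p t) * ?L (Suc m) zs"
    by (simp only: levels.simps map_append prod_list.append z branches.simps prod_shift)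
  have "?S (z # zs) * ?L m (z # zs) = step_weight p z * (?S zs * ?L (Suc m) zs)"
    unfolding L by (simp add: z)
  also have "\<dots> = step_weight p z * (\<Prod>z\<leftarrow>zs. step_weight p z)"
    by (rule arg_cong[where f = "(*) (step_weight p z)", OF Cons])
  finally show ?case by simp
qed simp

lemma prod_egwt_constraints:
  "(\<Prod>z\<leftarrow>zs. pmf p (fst (spine_step z))) * (\<Prod>c\<leftarrow>egwt_constraints t zs. pmf p (snd c)) =
     weight p (fold graft zs t)"
proof -
  have "(\<Prod>c\<leftarrow>map (\<lambda>(u, d). ((0::nat, u), d)) (degrees t). pmf p (snd c)) = weight p t"
    by (simp add: prod_degrees[symmetric] comp_def split_def)
  then have eq: "(\<Prod>c\<leftarrow>egwt_constraints t zs. pmf p (snd c)) =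
      weight p t * (\<Prod>c\<leftarrow>levels 1 zs. pmf p (snd c))"
    by (simp only: egwt_constraints_def map_append prod_list.append)
  have "a * (b * c) = b * (a * c)" for a b c :: real by (rule mult.left_commute)
  then show ?thesis
    unfolding eq weight_fold_graft prod_levels[where m = 1, symmetric] by blast
qed

section \<open>No coordinate is constrained twice\<close>

lemma shift_keys: "u \<in> fst ` set (shift j css) \<Longrightarrow> \<exists>i v. u = i # v \<and> j \<le> i \<and> i < j + length css"
proof (induction css arbitrary: j)
  case (Cons cs css)
  have "fst ` set (shift j (cs # css)) = (#) j ` fst ` set cs \<union> fst ` set (shift (Suc j) css)"
    by (simp add: image_Un image_image split_def)
  then consider v where "u = j # v" | "u \<in> fst ` set (shift (Suc j) css)"
    using Cons.prems by blast
  then show ?case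
  proof cases
    case 2
    then obtain i v where "u = i # v" "Suc j \<le> i" "i < Suc j + length css"
      using Cons.IH by blast
    then show ?thesis by (intro exI[of _ i] exI[of _ v]) simp
  qed simp
qed simp

lemma distinct_rename:
  assumes "inj h" "distinct (map fst cs)"
  shows "distinct (map fst (map (\<lambda>(u, d). (h u, d)) cs))"
proof -
  have "map fst (map (\<lambda>(u, d). (h u, d)) cs) = map h (map fst cs)" by auto
  moreover have "distinct (map h us)" if "distinct us" for us
    using that assms(1) by (simp add: distinct_map inj_on_subset[of h UNIV])
  ultimately show ?thesis using assms(2) by metis
qed

lemma distinct_keys_append:
  "distinct (map fst (cs @ ds)) \<longleftrightarrow>
     distinct (map fst cs) \<and> distinct (map fst ds) \<and> fst ` set cs \<inter> fst ` set ds = {}"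
  by simp

lemma distinct_shift:
  assumes "\<And>cs. cs \<in> set css \<Longrightarrow> distinct (map fst cs)"
  shows "distinct (map fst (shift j css))"
  using assms
proof (induction css arbitrary: j)
  case (Cons cs css)
  have "distinct (map fst (map (\<lambda>(u, d). (j # u, d)) cs))"
    using Cons.prems by (intro distinct_rename) (auto simp: inj_def)
  moreover have "distinct (map fst (shift (Suc j) css))" using Cons by auto
  moreover have "fst ` set (map (\<lambda>(u, d). (j # u, d)) cs) \<inter> fst ` set (shift (Suc j) css) = {}"
    using shift_keys[of _ "Suc j" css] by fastforce
  ultimately show ?case unfolding shift.simps distinct_keys_append by blast
qed simp

lemma distinct_degrees: "distinct (map fst (degrees t))"
proof (induction t)
  case (Node ts)
  then have "distinct (map fst (shift 0 (map degrees ts)))" by (intro distinct_shift) auto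
  then show ?case using shift_keys[of "[]" 0 "map degrees ts"] by auto
qed

lemma distinct_branches: "distinct (map fst (branches z))"
proof (cases z)
  case (Pair ls rs)
  have "fst ` set (shift 0 (map degrees ls)) \<inter> fst ` set (shift (Suc (length ls)) (map degrees rs)) = {}"
    using shift_keys[of _ 0 "map degrees ls"] shift_keys[of _ "Suc (length ls)" "map degrees rs"]
    by fastforce
  then show ?thesis
    unfolding Pair branches.simps distinct_keys_append
    by (auto intro!: distinct_shift distinct_degrees )
qed

lemma levels_keys: "x \<in> fst ` set (levels m zs) \<Longrightarrow> m \<le> fst x"
  by (induction zs arbitrary: m) (fastforce dest: Suc_leD)+

lemma distinct_levels: "distinct (map fst (levels m zs))"
proof (induction zs arbitrary: m)
  case (Cons z zs)
  have "fst ` set (map (\<lambda>(u, d). ((m, u), d)) (branches z)) \<inter> fst ` set (levels (Suc m) zs) = {}"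
    using levels_keys[of _ "Suc m" zs] by fastforce
  then show ?case using Cons distinct_rename[OF _ distinct_branches, of "Pair m" z]
    unfolding levels.simps distinct_keys_append by (simp add: inj_def)
qed simp

lemma distinct_egwt_constraints: "distinct (map fst (egwt_constraints t zs))"
proof -
  have "fst ` set (map (\<lambda>(u, d). ((0, u), d)) (degrees t)) \<inter> fst ` set (levels 1 zs) = {}"
    using levels_keys[of _ 1 zs] by fastforce
  then show ?thesis
    using distinct_levels[of 1 zs] distinct_rename[OF _ distinct_degrees, of "Pair 0" t]
    unfolding egwt_constraints_def distinct_keys_append by (simp add: inj_def)
qed

section \<open>Probabilities of cylinders in the source of the EGWT\<close>

lemma sets_PiM_finite_cylinder:
  assumes "finite J" "\<And>i. X i \<in> sets (M i)"
  shows "{f \<in> space (PiM UNIV M). \<forall>i\<in>J. f i \<in> X i} \<in> sets (PiM UNIV M)"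
proof (rule sets.sets_Collect_finite_All[OF _ assms(1)])
  fix i
  have "(\<lambda>f. f i) -` X i \<inter> space (PiM UNIV M) \<in> sets (PiM UNIV M)"
    using assms(2) by (intro measurable_sets[OF measurable_component_singleton]) auto
  then show "{f \<in> space (PiM UNIV M). f i \<in> X i} \<in> sets (PiM UNIV M)"
    by (simp add: vimage_def Int_def conj_commute)
qed

text \<open>Distinct keys make the list a finite partial function, so the product over coordinates
  given by independence is the product over the list.\<close>

lemma emeasure_sat:
  fixes p :: "nat pmf" and cs :: "('i \<times> nat) list"
  assumes "distinct (map fst cs)"
  shows "{f. sat f cs} \<in> sets (PiM UNIV (\<lambda>_::'i. measure_pmf p))"
    "emeasure (PiM UNIV (\<lambda>_::'i. measure_pmf p)) {f. sat f cs} = ennreal (\<Prod>c\<leftarrow>cs. pmf p (snd c))"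
proof -
  interpret product_prob_space "\<lambda>_::'i. measure_pmf p" UNIV
    by unfold_locales
  define X where "X i = {the (map_of cs i)}" for i
  have m: "map_of cs i = Some d" if "(i, d) \<in> set cs" for i d
    using assms that by (simp add: map_of_is_SomeI)
  have eq: "{f. sat f cs} = {f \<in> space (PiM UNIV (\<lambda>_::'i. measure_pmf p)). \<forall>i\<in>fst ` set cs. f i \<in> X i}"
    using m by (auto simp: space_PiM sat_def X_def)
  show "{f. sat f cs} \<in> sets (PiM UNIV (\<lambda>_::'i. measure_pmf p))"
    unfolding eq by (intro sets_PiM_finite_cylinder) auto
  have "emeasure (PiM UNIV (\<lambda>_::'i. measure_pmf p)) {f. sat f cs} =
      (\<Prod>i\<in>fst ` set cs. emeasure (measure_pmf p) (X i))"
    unfolding eq by (intro emeasure_PiM_Collect) auto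
  also have "\<dots> = ennreal (\<Prod>i\<in>set (map fst cs). pmf p (the (map_of cs i)))"
    by (simp add: X_def emeasure_pmf_single prod_ennreal)
  also have "(\<Prod>i\<in>set (map fst cs). pmf p (the (map_of cs i))) =
      (\<Prod>i\<leftarrow>map fst cs. pmf p (the (map_of cs i)))"
    using assms by (rule prod.distinct_set_conv_list)
  also have "map (\<lambda>i. pmf p (the (map_of cs i))) (map fst cs) = map (\<lambda>c. pmf p (snd c)) cs"
    using m by auto
  finally show "emeasure (PiM UNIV (\<lambda>_::'i. measure_pmf p)) {f. sat f cs} = ennreal (\<Prod>c\<leftarrow>cs. pmf p (snd c))" .
qed

lemma emeasure_PiM_initial:
  fixes q :: "'b pmf" and c :: "nat \<Rightarrow> 'b"
  shows "{f. \<forall>k<n. f k = c k} \<in> sets (PiM UNIV (\<lambda>_::nat. measure_pmf q))"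
    "emeasure (PiM UNIV (\<lambda>_::nat. measure_pmf q)) {f. \<forall>k<n. f k = c k} = ennreal (\<Prod>k<n. pmf q (c k))"
proof -
  interpret product_prob_space "\<lambda>_::nat. measure_pmf q" UNIV
    by unfold_locales
  have eq: "{f. \<forall>k<n. f k = c k} =
      {f \<in> space (PiM UNIV (\<lambda>_::nat. measure_pmf q)). \<forall>k\<in>{..<n}. f k \<in> {c k}}"
    by (auto simp: space_PiM)
  show "{f. \<forall>k<n. f k = c k} \<in> sets (PiM UNIV (\<lambda>_::nat. measure_pmf q))"
    unfolding eq by (intro sets_PiM_finite_cylinder) auto
  have "emeasure (PiM UNIV (\<lambda>_::nat. measure_pmf q)) {f. \<forall>k<n. f k = c k} =
      (\<Prod>k\<in>{..<n}. emeasure (measure_pmf q) {c k})"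
    unfolding eq by (intro emeasure_PiM_Collect) auto
  then show "emeasure (PiM UNIV (\<lambda>_::nat. measure_pmf q)) {f. \<forall>k<n. f k = c k} = ennreal (\<Prod>k<n. pmf q (c k))"
    by (simp add: emeasure_pmf_single prod_ennreal)
qed

text \<open>Mean 1 is the normalisation under which \<open>embed_pmf\<close> returns the prescribed
  masses.\<close>

lemma pmf_size_bias:
  assumes "(\<integral>\<^sup>+k. ennreal (real k) \<partial>measure_pmf p) = 1"
  shows "pmf (size_bias_pmf p) k = real k * pmf p k"
  unfolding size_bias_pmf_def
proof (rule pmf_embed_pmf)
  have "(\<integral>\<^sup>+k. ennreal (real k * pmf p k) \<partial>count_space UNIV) = (\<integral>\<^sup>+k. ennreal (real k) \<partial>measure_pmf p)"
    by (simp add: nn_integral_measure_pmf ennreal_mult' mult.commute)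
  then show "(\<integral>\<^sup>+k. ennreal (real k * pmf p k) \<partial>count_space UNIV) = 1"
    using assms by simp
qed simp

text \<open>The uniform position cancels the size bias.\<close>

lemma pmf_spine:
  assumes "(\<integral>\<^sup>+k. ennreal (real k) \<partial>measure_pmf p) = 1" "j < k"
  shows "pmf (spine_pmf p) (k, j) = pmf p k"
proof -
  have "pmf (map_pmf (\<lambda>j. (k', j)) (pmf_of_set {..<k'})) (k, j) = indicator {k} k' * (1 / real k)" for k'
  proof (cases "k' = k")
    case True
    have "pmf (map_pmf (Pair k) (pmf_of_set {..<k})) (Pair k j) = pmf (pmf_of_set {..<k}) j"
      by (rule pmf_map_inj') (simp add: inj_def)
    then show ?thesis using assms(2) True by (auto simp: lessThan_empty_iff)
  next
    case False
    \<comment> \<open>The first component alone excludes the pair; this covers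
      \<open>k' = 0\<close>, where \<open>pmf_of_set {}\<close> is unspecified.\<close>
    then have "(k, j) \<notin> set_pmf (map_pmf (\<lambda>j. (k', j)) (pmf_of_set {..<k'}))" by auto
    then have "pmf (map_pmf (\<lambda>j. (k', j)) (pmf_of_set {..<k'})) (k, j) = 0"
      by (simp only: pmf_eq_0_set_pmf not_False_eq_True)
    then show ?thesis using False by simp
  qed
  then have "pmf (spine_pmf p) (k, j) = (\<integral>k'. indicator {k} k' * (1 / real k) \<partial>measure_pmf (size_bias_pmf p))"
    unfolding spine_pmf_def pmf_bind by simp
  also have "\<dots> = pmf (size_bias_pmf p) k * (1 / real k)"
    by (simp add: measure_pmf_single)
  also have "\<dots> = pmf p k"
    using assms by (simp add: pmf_size_bias)
  finally show ?thesis .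
qed

definition egwt_cylinder ::
  "plane_tree \<Rightarrow> (plane_tree list \<times> plane_tree list) list \<Rightarrow> egwt_src set" where
  "egwt_cylinder t zs =
     {f. \<forall>k<length zs. f k = spine_step (zs ! k)} \<times> {g. sat g (egwt_constraints t zs)}"

lemma egwt_cylinder_agrees: "w \<in> egwt_cylinder t zs \<Longrightarrow> code_agrees t zs (egwt_code w)"
  by (rule egwt_code_agrees) (auto simp: egwt_cylinder_def)

lemma prob_space_egwt_source: "prob_space (egwt_source p)"
proof -
  have "prob_space (PiM UNIV (\<lambda>_::nat. measure_pmf (spine_pmf p)))"
    "prob_space (PiM UNIV (\<lambda>_::nat \<times> nat list. measure_pmf p))"
    by (auto intro!: prob_space_PiM prob_space_measure_pmf)
  then interpret pair_prob_space "PiM UNIV (\<lambda>_::nat. measure_pmf (spine_pmf p))"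
      "PiM UNIV (\<lambda>_::nat \<times> nat list. measure_pmf p)"
    by (simp add: pair_prob_space_def pair_sigma_finite_def prob_space_imp_sigma_finite)
  show ?thesis unfolding egwt_source_def by unfold_locales
qed

lemma emeasure_egwt_cylinder:
  assumes "(\<integral>\<^sup>+k. ennreal (real k) \<partial>measure_pmf p) = 1"
  shows "egwt_cylinder t zs \<in> sets (egwt_source p)"
    "emeasure (egwt_source p) (egwt_cylinder t zs) = ennreal (weight p (fold graft zs t))"
proof -
  interpret B: prob_space "PiM UNIV (\<lambda>_::nat \<times> nat list. measure_pmf p)"
    by (auto intro!: prob_space_PiM prob_space_measure_pmf)
  note A = emeasure_PiM_initial[where n = "length zs" and c = "\<lambda>k. spine_step (zs ! k)" and q = "spine_pmf p"]
  note C = emeasure_sat[OF distinct_egwt_constraints[of t zs], where p = p]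
  show "egwt_cylinder t zs \<in> sets (egwt_source p)"
    unfolding egwt_cylinder_def egwt_source_def using A(1) C(1) by (rule pair_measureI)
  have "pmf (spine_pmf p) (spine_step z) = pmf p (fst (spine_step z))" for z
    by (cases z) (simp add: pmf_spine assms)
  then have "(\<Prod>k<length zs. pmf (spine_pmf p) (spine_step (zs ! k))) =
      (\<Prod>z\<leftarrow>zs. pmf p (fst (spine_step z)))"
    by (simp add: prod.list_conv_set_nth atLeast0LessThan)
  moreover have "emeasure (egwt_source p) (egwt_cylinder t zs) =
      ennreal (\<Prod>k<length zs. pmf (spine_pmf p) (spine_step (zs ! k))) *
      ennreal (\<Prod>c\<leftarrow>egwt_constraints t zs. pmf p (snd c))"
    unfolding egwt_cylinder_def egwt_source_def A(2)[symmetric] C(2)[symmetric]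
    using A(1) C(1) by (rule B.emeasure_pair_measure_Times)
  moreover have "0 \<le> (\<Prod>z\<leftarrow>zs. pmf p (fst (spine_step z)))"
    by (rule prod_list_nonneg) auto
  ultimately show "emeasure (egwt_source p) (egwt_cylinder t zs) = ennreal (weight p (fold graft zs t))"
    by (simp add: prod_egwt_constraints[symmetric] ennreal_mult')
qed

section \<open>Total mass of the weights\<close>

lemma nn_integral_count_space_swap:
  "(\<integral>\<^sup>+x. \<integral>\<^sup>+y. f x y \<partial>count_space UNIV \<partial>count_space UNIV) =
   (\<integral>\<^sup>+y. \<integral>\<^sup>+x. f x y \<partial>count_space UNIV \<partial>count_space UNIV)"
  using nn_integral_fst_count_space[of "\<lambda>(x, y). f x y"]
    nn_integral_snd_count_space[of "\<lambda>(x, y). f x y"] by simp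

lemma nn_integral_lists_length:
  fixes g :: "'a \<Rightarrow> ennreal"
  shows "(\<integral>\<^sup>+xs. prod_list (map g xs) * indicator {xs. length xs = n} xs \<partial>count_space UNIV) =
    (\<integral>\<^sup>+x. g x \<partial>count_space UNIV) ^ n"
proof (induction n)
  case 0
  have "(\<integral>\<^sup>+xs. prod_list (map g xs) * indicator {xs. length xs = 0} xs \<partial>count_space UNIV) =
      (\<integral>\<^sup>+xs. indicator {[] :: 'a list} xs \<partial>count_space UNIV)"
    by (intro nn_integral_cong) (auto simp: indicator_def)
  then show ?case by simp
next
  case (Suc n)
  have bij: "bij_betw (\<lambda>(x, xs). x # xs) (UNIV \<times> {xs. length xs = n}) {xs :: 'a list. length xs = Suc n}"
    by (rule bij_betw_byWitness[where f' = "\<lambda>xs. (hd xs, tl xs)"]) (auto simp: length_Suc_conv)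
  have "(\<integral>\<^sup>+xs. prod_list (map g xs) * indicator {xs. length xs = Suc n} xs \<partial>count_space UNIV) =
      (\<integral>\<^sup>+xs. prod_list (map g xs) \<partial>count_space {xs. length xs = Suc n})"
    by (subst nn_integral_count_space_indicator) auto
  also have "\<dots> = (\<integral>\<^sup>+(x, xs). g x * prod_list (map g xs) \<partial>count_space (UNIV \<times> {xs. length xs = n}))"
    unfolding nn_integral_bij_count_space[OF bij, symmetric] by (simp add: split_def)
  also have "\<dots> = (\<integral>\<^sup>+(x, xs). g x * (prod_list (map g xs) * indicator {xs. length xs = n} xs) \<partial>count_space UNIV)"
    by (subst nn_integral_count_space_indicator)
       (auto intro!: nn_integral_cong simp: indicator_def)
  also have "\<dots> = (\<integral>\<^sup>+x. \<integral>\<^sup>+xs. g x * (prod_list (map g xs) * indicator {xs. length xs = n} xs)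
      \<partial>count_space UNIV \<partial>count_space UNIV)"
    by (subst nn_integral_fst_count_space[symmetric]) simp
  also have "\<dots> = (\<integral>\<^sup>+x. g x \<partial>count_space UNIV) ^ Suc n"
    by (simp add: nn_integral_cmult nn_integral_multc Suc)
  finally show ?case .
qed

text \<open>Grouping lists by length yields a power series in the mass of one entry; for lists of
  trees with \<open>h = pmf p\<close> it is the generating function of the offspring law.\<close>

lemma nn_integral_lists:
  fixes g :: "'a \<Rightarrow> ennreal"
  shows "(\<integral>\<^sup>+xs. h (length xs) * prod_list (map g xs) \<partial>count_space UNIV) =
    (\<integral>\<^sup>+k. h k * (\<integral>\<^sup>+x. g x \<partial>count_space UNIV) ^ k \<partial>count_space UNIV)"
proof -
  have "(\<integral>\<^sup>+k. h k * (\<integral>\<^sup>+x. g x \<partial>count_space UNIV) ^ k \<partial>count_space UNIV) =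
      (\<integral>\<^sup>+k. \<integral>\<^sup>+xs. h k * (prod_list (map g xs) * indicator {xs. length xs = k} xs)
         \<partial>count_space UNIV \<partial>count_space UNIV)"
    by (simp add: nn_integral_cmult nn_integral_lists_length)
  also have "\<dots> = (\<integral>\<^sup>+xs. \<integral>\<^sup>+k. h k * (prod_list (map g xs) * indicator {xs. length xs = k} xs)
         \<partial>count_space UNIV \<partial>count_space UNIV)"
    by (rule nn_integral_count_space_swap)
  also have "\<dots> = (\<integral>\<^sup>+xs. \<integral>\<^sup>+k. h (length xs) * prod_list (map g xs) * indicator {length xs} k
         \<partial>count_space UNIV \<partial>count_space UNIV)"
    by (intro nn_integral_cong) (auto simp: indicator_def)
  also have "\<dots> = (\<integral>\<^sup>+xs. h (length xs) * prod_list (map g xs) \<partial>count_space UNIV)"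
    by (simp add: nn_integral_cmult_indicator)
  finally show ?thesis by simp
qed

lemma ennreal_prod_list:
  "(\<And>x. 0 \<le> f x) \<Longrightarrow> ennreal (\<Prod>x\<leftarrow>xs. f x) = (\<Prod>x\<leftarrow>xs. ennreal (f x))"
  by (induction xs) (auto simp: ennreal_mult' prod_list_nonneg)

lemma prod_weight_nonneg [simp]: "0 \<le> (\<Prod>t\<leftarrow>ts. weight p t)"
  by (rule prod_list_nonneg) auto

lemma nn_integral_weight_fixpoint:
  fixes p :: "nat pmf"
  defines "Q \<equiv> \<integral>\<^sup>+t. ennreal (weight p t) \<partial>count_space UNIV"
  shows "Q = (\<integral>\<^sup>+k. Q ^ k \<partial>measure_pmf p)"
proof -
  have bij: "bij Node" by (metis bij_def injI plane_tree.inject surjI plane_tree.collapse)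
  have "Q = (\<integral>\<^sup>+ts. ennreal (weight p (Node ts)) \<partial>count_space UNIV)"
    unfolding Q_def by (rule nn_integral_bij_count_space[OF bij, symmetric])
  also have "\<dots> = (\<integral>\<^sup>+ts. ennreal (pmf p (length ts)) * (\<Prod>t\<leftarrow>ts. ennreal (weight p t)) \<partial>count_space UNIV)"
    by (simp add: weight_Node ennreal_mult' ennreal_prod_list)
  also have "\<dots> = (\<integral>\<^sup>+k. ennreal (pmf p k) * Q ^ k \<partial>count_space UNIV)"
    unfolding Q_def by (rule nn_integral_lists)
  finally show ?thesis by (simp add: nn_integral_measure_pmf)
qed

text \<open>The weights are probabilities of disjoint events in the source (cylinders with empty
  spine). The fixed point equation alone would not exclude an infinite total.\<close>

lemma nn_integral_weight_le_1:
  assumes "(\<integral>\<^sup>+k. ennreal (real k) \<partial>measure_pmf p) = 1"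
  shows "(\<integral>\<^sup>+t. ennreal (weight p t) \<partial>count_space UNIV) \<le> 1"
proof -
  interpret prob_space "egwt_source p" by (rule prob_space_egwt_source)
  have "disjoint_family (\<lambda>t. egwt_cylinder t [])"
    unfolding disjoint_family_on_def
    using code_agrees_inject egwt_cylinder_agrees by blast
  then have "(\<integral>\<^sup>+t. emeasure (egwt_source p) (egwt_cylinder t []) \<partial>count_space UNIV) =
      emeasure (egwt_source p) (\<Union>t. egwt_cylinder t [])"
    by (intro emeasure_UN_countable[symmetric]) (auto simp: emeasure_egwt_cylinder assms)
  also have "\<dots> \<le> 1" by (rule measure_le_1)
  finally show ?thesis by (simp add: emeasure_egwt_cylinder assms)
qed

text \<open>Bernoulli's inequality made strict: one factor \<open>q\<close> is split off before it
  is applied, and this gains \<open>m * (1 - q)^2\<close>, which is positive since \<open>k\<close>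
  is at least 2.\<close>

lemma power_gt_tangent:
  fixes q :: real
  assumes "0 \<le> q" "q < 1" "2 \<le> k"
  shows "1 - real k * (1 - q) < q ^ k"
proof -
  obtain m where k: "k = Suc m" using assms(3) by (cases k) auto
  have "1 - real k * (1 - q) = q * (1 + real m * (q - 1)) - real m * (1 - q)\<^sup>2"
    by (simp add: k power2_eq_square algebra_simps)
  also have "\<dots> < q * (1 + real m * (q - 1))"
    using assms k by simp
  also have "\<dots> \<le> q * q ^ m"
    using Bernoulli_inequality[of "q - 1" m] assms(1) by (intro mult_left_mono) auto
  finally show ?thesis by (simp add: k)
qed

text \<open>Criticality: the tangent of \<open>q \<mapsto> q ^ k\<close> at 1 turns the fixed point equation for the
  extinction probability into an equality that is only possible at 1.\<close>

lemma nn_integral_weight_eq_1: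
  assumes mean: "(\<integral>\<^sup>+k. ennreal (real k) \<partial>measure_pmf p) = 1" and "0 < pmf p 0"
  shows "(\<integral>\<^sup>+t. ennreal (weight p t) \<partial>count_space UNIV) = 1"
proof -
  define Q where "Q = (\<integral>\<^sup>+t. ennreal (weight p t) \<partial>count_space UNIV)"
  have "Q \<le> 1" unfolding Q_def by (rule nn_integral_weight_le_1[OF mean])
  then obtain q where q: "Q = ennreal q" "0 \<le> q" "q \<le> 1"
    by (cases Q) (auto simp: top_unique)
  have int: "integrable (measure_pmf p) real" "(\<integral>k. real k \<partial>measure_pmf p) = 1"
    using nn_integral_eq_integrable[of real "measure_pmf p" 1] mean by auto
  have intq: "integrable (measure_pmf p) (\<lambda>k. q ^ k)"
    using q by (intro measure_pmf.integrable_const_bound[where B = 1]) (auto simp: power_le_one)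
  have "ennreal q = ennreal (\<integral>k. q ^ k \<partial>measure_pmf p)"
  proof -
    have "Q = (\<integral>\<^sup>+k. ennreal (q ^ k) \<partial>measure_pmf p)"
      using nn_integral_weight_fixpoint[of p] q by (simp add: Q_def ennreal_power)
    also have "\<dots> = ennreal (\<integral>k. q ^ k \<partial>measure_pmf p)"
      using intq q by (intro nn_integral_eq_integral) auto
    finally show ?thesis using q by simp
  qed
  then have fix_q: "(\<integral>k. q ^ k \<partial>measure_pmf p) = q"
    using q by (simp add: integral_nonneg_AE)
  have "q = 1"
  proof (rule ccontr)
    assume "q \<noteq> 1"
    with q have "q < 1" by simp
    have ge: "0 \<le> q ^ k - (1 - real k * (1 - q))" for k
      using Bernoulli_inequality[of "q - 1" k] q by (simp add: algebra_simps)
    \<comment> \<open>Both terms have expectation \<open>q\<close>: the power by the fixed point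
      equation, its tangent because the mean is 1.\<close>
    have "(\<integral>k. q ^ k - (1 - real k * (1 - q)) \<partial>measure_pmf p) = 0"
      using int intq fix_q by simp
    then have "AE k in measure_pmf p. q ^ k - (1 - real k * (1 - q)) = 0"
      using ge int intq by (subst (asm) integral_nonneg_eq_0_iff_AE) auto
    then have le: "k \<le> 1" if "k \<in> set_pmf p" for k
      using that power_gt_tangent[OF q(2) \<open>q < 1\<close>, of k] by (force simp: AE_measure_pmf_iff)
    \<comment> \<open>On a support inside {0, 1} the variable 1 - k is nonnegative, so mean 1 forces
      k = 1 almost surely, against \<open>0 < pmf p 0\<close>.\<close>
    have "(\<integral>k. 1 - real k \<partial>measure_pmf p) = 0" using int by simp
    then have "AE k in measure_pmf p. 1 - real k = 0"
      using le int by (subst (asm) integral_nonneg_eq_0_iff_AE) (auto simp: AE_measure_pmf_iff)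
    moreover have "0 \<in> set_pmf p" using assms(2) by (simp add: set_pmf_iff)
    ultimately show False by (auto simp: AE_measure_pmf_iff)
  qed
  then show ?thesis using q by (simp add: Q_def)
qed

text \<open>With tree mass 1 only the numbers a and b of left and right subtrees remain.
  Substituting k = a + 1 + b and exchanging the sums counts the k positions a < k, which produces
  the mean.\<close>

lemma nn_integral_step_weight:
  assumes mean: "(\<integral>\<^sup>+k. ennreal (real k) \<partial>measure_pmf p) = 1" and "0 < pmf p 0"
  shows "(\<integral>\<^sup>+z. ennreal (step_weight p z) \<partial>count_space UNIV) = 1"
proof -
  let ?W = "\<lambda>ts. \<Prod>t\<leftarrow>ts. ennreal (weight p t)"
  have "(\<integral>\<^sup>+z. ennreal (step_weight p z) \<partial>count_space UNIV) =
      (\<integral>\<^sup>+(ls, rs). ennreal (pmf p (length ls + 1 + length rs)) * ?W rs * ?W ls \<partial>count_space UNIV)"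
    by (intro nn_integral_cong)
       (auto simp: ennreal_mult ennreal_prod_list[symmetric] mult_ac)
  also have "\<dots> = (\<integral>\<^sup>+ls. (\<integral>\<^sup>+rs. ennreal (pmf p (length ls + 1 + length rs)) * ?W rs \<partial>count_space UNIV) * ?W ls
      \<partial>count_space UNIV)"
    unfolding nn_integral_fst_count_space[symmetric] by (simp add: nn_integral_multc)
  also have "\<dots> = (\<integral>\<^sup>+a. \<integral>\<^sup>+b. ennreal (pmf p (a + 1 + b)) \<partial>count_space UNIV \<partial>count_space UNIV)"
    using nn_integral_lists[where h = "\<lambda>b. ennreal (pmf p (_ + 1 + b))" and g = "\<lambda>t. ennreal (weight p t)"]
      nn_integral_lists[where h = "\<lambda>a. \<integral>\<^sup>+b. ennreal (pmf p (a + 1 + b)) \<partial>count_space UNIV"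
        and g = "\<lambda>t. ennreal (weight p t)"]
    by (simp add: nn_integral_weight_eq_1 assms)
  also have "\<dots> = (\<integral>\<^sup>+a. \<integral>\<^sup>+k. ennreal (pmf p k) * indicator {a<..} k \<partial>count_space UNIV \<partial>count_space UNIV)"
  proof (rule nn_integral_cong)
    fix a :: nat
    have bij: "bij_betw (\<lambda>b. a + 1 + b) UNIV {a<..}"
      by (rule bij_betw_byWitness[where f' = "\<lambda>k. k - (a + 1)"]) auto
    show "(\<integral>\<^sup>+b. ennreal (pmf p (a + 1 + b)) \<partial>count_space UNIV) =
        (\<integral>\<^sup>+k. ennreal (pmf p k) * indicator {a<..} k \<partial>count_space UNIV)"
      using nn_integral_bij_count_space[OF bij, of "\<lambda>k. ennreal (pmf p k)"]
      by (simp add: nn_integral_count_space_indicator)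
  qed
  also have "\<dots> = (\<integral>\<^sup>+k. \<integral>\<^sup>+a. ennreal (pmf p k) * indicator {..<k} a \<partial>count_space UNIV \<partial>count_space UNIV)"
    unfolding nn_integral_count_space_swap[of "\<lambda>a k. ennreal (pmf p k) * indicator {a<..} k"]
    by (intro nn_integral_cong) (auto simp: indicator_def)
  also have "\<dots> = (\<integral>\<^sup>+k. ennreal (real k) \<partial>measure_pmf p)"
    by (simp add: nn_integral_cmult_indicator nn_integral_measure_pmf ennreal_of_nat_eq_real_of_nat)
  finally show ?thesis using mean by simp
qed

lemma nn_integral_spine_weight:
  assumes "(\<integral>\<^sup>+k. ennreal (real k) \<partial>measure_pmf p) = 1" "0 < pmf p 0"
  shows "(\<integral>\<^sup>+(t, zs). ennreal (weight p (fold graft zs t)) * indicator {zs. length zs = n} zs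
           \<partial>count_space UNIV) = 1"
proof -
  have nonneg: "0 \<le> step_weight p z" for z
    by (cases z) (auto intro!: mult_nonneg_nonneg prod_list_nonneg)
  have "(\<integral>\<^sup>+(t, zs). ennreal (weight p (fold graft zs t)) * indicator {zs. length zs = n} zs \<partial>count_space UNIV) =
      (\<integral>\<^sup>+(t, zs). ennreal (weight p t) * ((\<Prod>z\<leftarrow>zs. ennreal (step_weight p z)) * indicator {zs. length zs = n} zs)
        \<partial>count_space UNIV)"
    by (simp add: weight_fold_graft ennreal_mult' ennreal_prod_list nonneg mult.assoc)
  also have "\<dots> = (\<integral>\<^sup>+t. \<integral>\<^sup>+zs. ennreal (weight p t) *
      ((\<Prod>z\<leftarrow>zs. ennreal (step_weight p z)) * indicator {zs. length zs = n} zs) \<partial>count_space UNIV \<partial>count_space UNIV)"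
    by (subst nn_integral_fst_count_space[symmetric]) simp
  also have "\<dots> = 1"
    by (simp add: nn_integral_cmult nn_integral_multc nn_integral_lists_length
        nn_integral_step_weight nn_integral_weight_eq_1 assms)
  finally show ?thesis .
qed

section \<open>The sigma-algebra on codes and finitely determined events\<close>

lemma space_tree_space [simp]: "space tree_space = UNIV"
  by (simp add: tree_space_def space_pair_measure space_PiM)

lemma measurable_tree_spaceI:
  assumes "\<And>k. (\<lambda>w. fst (f w) k) \<in> N \<rightarrow>\<^sub>M count_space UNIV"
    and "\<And>k u. (\<lambda>w. snd (f w) k u) \<in> N \<rightarrow>\<^sub>M count_space UNIV"
  shows "f \<in> N \<rightarrow>\<^sub>M tree_space"
proof -
  have "(\<lambda>w. fst (f w)) \<in> N \<rightarrow>\<^sub>M PiM UNIV (\<lambda>_::nat. count_space (UNIV::nat set))"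
    by (rule measurable_PiM_single') (use assms(1) in auto)
  moreover have "(\<lambda>w. snd (f w)) \<in> N \<rightarrow>\<^sub>M
      PiM UNIV (\<lambda>_::nat. PiM UNIV (\<lambda>_::nat list. count_space (UNIV::bool set)))"
    by (rule measurable_PiM_single', rule measurable_PiM_single') (use assms(2) in \<open>auto simp: space_PiM\<close>)
  ultimately have "(\<lambda>w. (fst (f w), snd (f w))) \<in> N \<rightarrow>\<^sub>M tree_space"
    unfolding tree_space_def by (rule measurable_Pair)
  then show ?thesis by simp
qed

lemma measurable_tree_space_fst: "(\<lambda>c. fst c k) \<in> tree_space \<rightarrow>\<^sub>M count_space UNIV"
  unfolding tree_space_def
  by (rule measurable_compose[OF measurable_fst measurable_component_singleton]) auto

lemma measurable_tree_space_snd: "(\<lambda>c. snd c k u) \<in> tree_space \<rightarrow>\<^sub>M count_space UNIV"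
proof -
  have "(\<lambda>c. snd c k) \<in> tree_space \<rightarrow>\<^sub>M PiM UNIV (\<lambda>_::nat list. count_space (UNIV::bool set))"
    unfolding tree_space_def
    by (rule measurable_compose[OF measurable_snd measurable_component_singleton]) simp
  then show ?thesis by (rule measurable_compose[OF _ measurable_component_singleton]) simp
qed

text \<open>Positions strictly below \<open>n\<close> but trees up to and including
  \<open>n\<close>: exactly what \<open>code_agrees\<close> fixes when \<open>zs\<close> has length
  \<open>n\<close>.\<close>

definition determined :: "nat \<Rightarrow> ((nat \<Rightarrow> nat) \<times> (nat \<Rightarrow> nat list \<Rightarrow> bool)) set \<Rightarrow> bool" where
  "determined n C \<longleftrightarrow>
     (\<forall>c d. (\<forall>k<n. fst c k = fst d k) \<longrightarrow> (\<forall>k\<le>n. snd c k = snd d k) \<longrightarrow> (c \<in> C \<longleftrightarrow> d \<in> C))"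

lemma determined_mono: "determined m C \<Longrightarrow> m \<le> n \<Longrightarrow> determined n C"
  unfolding determined_def by (meson order.strict_trans2 order.trans)

text \<open>The identity is measurable from the generated sigma-algebra, since every coordinate
  event is determined: a position at time \<open>k\<close> by generation \<open>Suc k\<close>, an
  address at time \<open>k\<close> by generation \<open>k\<close>.\<close>

lemma sets_tree_space:
  "sets tree_space = sigma_sets UNIV {C \<in> sets tree_space. \<exists>n. determined n C}" (is "_ = sigma_sets UNIV ?G")
proof
  have "(\<lambda>c. c) \<in> sigma UNIV ?G \<rightarrow>\<^sub>M tree_space"
  proof (rule measurable_tree_spaceI)
    have G: "C \<in> sets (sigma UNIV ?G)" if "C \<in> sets tree_space" "determined n C" for n C
      using that by (auto intro: sigma_sets.Basic)
    have fst: "(\<lambda>c. fst c k) -` {a} \<inter> space tree_space \<in> sets tree_space" for k a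
      using measurable_tree_space_fst by (rule measurable_sets) simp
    have snd: "(\<lambda>c. snd c k u) -` {b} \<inter> space tree_space \<in> sets tree_space" for k u b
      using measurable_tree_space_snd by (rule measurable_sets) simp
    show "(\<lambda>c. fst c k) \<in> sigma UNIV ?G \<rightarrow>\<^sub>M count_space UNIV" for k
      using fst[of k] G[of "{c. fst c k = _}" "Suc k"]
      by (simp add: measurable_count_space_eq2_countable vimage_def determined_def)
    show "(\<lambda>c. snd c k u) \<in> sigma UNIV ?G \<rightarrow>\<^sub>M count_space UNIV" for k u
      using snd[of k u] G[of "{c. snd c k u = _}" k]
      by (simp add: measurable_count_space_eq2_countable vimage_def determined_def)
  qed
  then have "C \<in> sets (sigma UNIV ?G)" if "C \<in> sets tree_space" for C
    using measurable_sets[of "\<lambda>c. c", OF _ that] by fastforce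
  then show "sets tree_space \<subseteq> sigma_sets UNIV ?G" by auto
  show "sigma_sets UNIV ?G \<subseteq> sets tree_space"
    using sets.sigma_sets_subset[of ?G tree_space] by auto
qed

section \<open>Comparison of laws through cylinders\<close>

definition spine_code ::
  "plane_tree \<Rightarrow> (plane_tree list \<times> plane_tree list) list \<Rightarrow>
     (nat \<Rightarrow> nat) \<times> (nat \<Rightarrow> nat list \<Rightarrow> bool)" where
  "spine_code t zs = (\<lambda>k. length (fst (zs ! k)), \<lambda>k. address (fold graft (take k zs) t))"

text \<open>Membership in a determined event is constant on a cylinder, so one representative code
  turns the event into a set of pairs \<open>(t, zs)\<close>.\<close>

lemma determined_spine_code:
  assumes "determined (length zs) C" "code_agrees t zs c"
  shows "c \<in> C \<longleftrightarrow> spine_code t zs \<in> C"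
proof -
  have "\<forall>k<length zs. fst c k = fst (spine_code t zs) k"
    "\<forall>k\<le>length zs. snd c k = snd (spine_code t zs) k"
    using assms(2) by (simp_all add: code_agrees_def spine_code_def fun_eq_iff)
  with assms(1) show ?thesis unfolding determined_def by blast
qed

lemma determined_Compl: "determined n C \<Longrightarrow> determined n (- C)"
  by (auto simp: determined_def)

text \<open>Two lower bounds whose sum is already the whole mass leave no slack. Cancelling
  \<open>d\<close> is legitimate because \<open>c + d = 1\<close> makes it finite.\<close>

lemma ennreal_add_eq_1_antimono:
  fixes a b c d :: ennreal
  assumes "a \<le> c" "b \<le> d" "a + b = 1" "c + d = 1"
  shows "c = a"
proof -
  have "c + d \<le> a + d" using assms by (metis add_left_mono)
  moreover have "d \<noteq> \<top>" using assms(4) by auto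
  ultimately show ?thesis
    using assms(1) by (metis add.commute antisym ennreal_add_left_cancel_le infinity_ennreal_def)
qed

text \<open>Since the cylinders of generation \<open>n\<close> are disjoint with total mass 1, lower bounds for an
  event and for its complement already determine the law; no information outside of the cylinders
  (in particular no almost sure finiteness) is needed.\<close>

lemma law_determined:
  assumes mean: "(\<integral>\<^sup>+k. ennreal (real k) \<partial>measure_pmf p) = 1" and pos: "0 < pmf p 0"
    and N: "prob_space N" and f: "f \<in> N \<rightarrow>\<^sub>M tree_space"
    and E: "\<And>t zs. E t zs \<in> sets N"
      "\<And>t zs. emeasure N (E t zs) = ennreal (weight p (fold graft zs t))"
      "\<And>t zs w. w \<in> E t zs \<Longrightarrow> code_agrees t zs (f w)"
    and C: "determined n C" "C \<in> sets tree_space"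
  shows "emeasure (distr N tree_space f) C =
    (\<integral>\<^sup>+(t, zs). ennreal (weight p (fold graft zs t)) *
       indicator {(t, zs). length zs = n \<and> spine_code t zs \<in> C} (t, zs) \<partial>count_space UNIV)"
proof -
  interpret prob_space N by (rule N)
  define J where "J C = {(t, zs). length zs = n \<and> spine_code t zs \<in> C}" for C
  define S where "S C = (\<integral>\<^sup>+(t, zs). ennreal (weight p (fold graft zs t)) * indicator (J C) (t, zs) \<partial>count_space UNIV)" for C
  have disj: "disjoint_family_on (\<lambda>(t, zs). E t zs) (J C)" for C
    unfolding disjoint_family_on_def
  proof (intro ballI impI)
    fix y z assume yz: "y \<in> J C" "z \<in> J C" "y \<noteq> z"
    obtain s ys t zs where eq: "y = (s, ys)" "z = (t, zs)" by fastforce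
    have "w \<notin> E t zs" if "w \<in> E s ys" for w
      using code_agrees_inject[OF E(3)[OF that] E(3)] yz by (auto simp: J_def eq)
    then show "(case y of (t, zs) \<Rightarrow> E t zs) \<inter> (case z of (t, zs) \<Rightarrow> E t zs) = {}"
      by (auto simp: eq)
  qed
  have lower: "S C \<le> emeasure (distr N tree_space f) C" if "determined n C" "C \<in> sets tree_space" for C
  proof -
    have "S C = (\<integral>\<^sup>+z. emeasure N (case z of (t, zs) \<Rightarrow> E t zs) \<partial>count_space (J C))"
      unfolding S_def by (subst (2) nn_integral_count_space_indicator)
        (auto intro!: nn_integral_cong simp: E)
    also have "\<dots> = emeasure N (\<Union>z\<in>J C. case z of (t, zs) \<Rightarrow> E t zs)"
      using disj by (intro emeasure_UN_countable[symmetric]) (auto simp: E)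
    also have "\<dots> \<le> emeasure N (f -` C \<inter> space N)"
    proof (rule emeasure_mono)
      show "(\<Union>z\<in>J C. case z of (t, zs) \<Rightarrow> E t zs) \<subseteq> f -` C \<inter> space N"
        using determined_spine_code[OF _ E(3)] that(1) sets.sets_into_space[OF E(1)]
        by (fastforce simp: J_def)
      show "f -` C \<inter> space N \<in> sets N" using f that(2) by (rule measurable_sets)
    qed
    finally show ?thesis using f that(2) by (simp add: emeasure_distr)
  qed
  \<comment> \<open>Each pair \<open>(t, zs)\<close> of generation \<open>n\<close> is counted by
    exactly one of the two sums.\<close>
  have "S C + S (- C) =
      (\<integral>\<^sup>+(t, zs). ennreal (weight p (fold graft zs t)) * indicator {zs. length zs = n} zs \<partial>count_space UNIV)"
    unfolding S_def
    by (subst nn_integral_add[symmetric]) (auto intro!: nn_integral_cong simp: J_def indicator_def)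
  then have "S C + S (- C) = 1" using nn_integral_spine_weight[OF mean pos] by simp
  moreover have compl: "- C \<in> sets tree_space"
    using sets.compl_sets[OF C(2)] by (simp add: Compl_eq_Diff_UNIV)
  moreover have "emeasure (distr N tree_space f) C + emeasure (distr N tree_space f) (- C) = 1"
  proof -
    interpret D: prob_space "distr N tree_space f" using f by (rule prob_space_distr)
    have "emeasure (distr N tree_space f) C + emeasure (distr N tree_space f) (- C) =
        emeasure (distr N tree_space f) (C \<union> - C)"
      using C(2) compl by (intro plus_emeasure) auto
    then show ?thesis using D.emeasure_space_1 by simp
  qed
  ultimately have "emeasure (distr N tree_space f) C = S C"
    using lower[OF C] lower[OF determined_Compl[OF C(1)] compl] ennreal_add_eq_1_antimono by blast
  then show ?thesis by (simp add: S_def J_def)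
qed

text \<open>The formula of \<open>law_determined\<close> mentions neither the source nor the map, so
  the laws agree on determined events; these form a pi-system because two of them are determined by
  a common generation.\<close>

lemma law_unique:
  assumes mean: "(\<integral>\<^sup>+k. ennreal (real k) \<partial>measure_pmf p) = 1" and pos: "0 < pmf p 0"
    and N: "prob_space N" and f: "f \<in> N \<rightarrow>\<^sub>M tree_space"
    and E: "\<And>t zs. E t zs \<in> sets N"
      "\<And>t zs. emeasure N (E t zs) = ennreal (weight p (fold graft zs t))"
      "\<And>t zs w. w \<in> E t zs \<Longrightarrow> code_agrees t zs (f w)"
    and N': "prob_space N'" and f': "f' \<in> N' \<rightarrow>\<^sub>M tree_space"
    and E': "\<And>t zs. E' t zs \<in> sets N'"
      "\<And>t zs. emeasure N' (E' t zs) = ennreal (weight p (fold graft zs t))"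
      "\<And>t zs w. w \<in> E' t zs \<Longrightarrow> code_agrees t zs (f' w)"
  shows "distr N tree_space f = distr N' tree_space f'"
proof (rule measure_eqI_generator_eq)
  let ?G = "{C \<in> sets tree_space. \<exists>n. determined n C}"
  show "Int_stable ?G"
  proof (rule Int_stableI)
    fix A B assume "A \<in> ?G" "B \<in> ?G"
    then obtain m n where "determined m A" "determined n B" "A \<in> sets tree_space" "B \<in> sets tree_space"
      by auto
    moreover from this have "determined (max m n) A" "determined (max m n) B"
      by (auto intro: determined_mono)
    then have "determined (max m n) (A \<inter> B)" unfolding determined_def Int_iff by meson
    ultimately show "A \<inter> B \<in> ?G" by auto
  qed
  show "emeasure (distr N tree_space f) C = emeasure (distr N' tree_space f') C" if "C \<in> ?G" for C
    using that law_determined[OF mean pos N f E] law_determined[OF mean pos N' f' E'] by auto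
  show "sets (distr N tree_space f) = sigma_sets UNIV ?G" "sets (distr N' tree_space f') = sigma_sets UNIV ?G"
    using sets_tree_space by simp_all
  show "range (\<lambda>_::nat. UNIV) \<subseteq> ?G"
    using sets.top[of tree_space] by (auto simp: determined_def)
  show "emeasure (distr N tree_space f) UNIV \<noteq> \<infinity>" 
    using prob_space.emeasure_space_1[OF prob_space.prob_space_distr[OF N f]] by simp
qed auto

section \<open>Measurability of both codes\<close>

lemma measurable_gw_tree:
  assumes "\<And>u. (\<lambda>w. h w u) \<in> N \<rightarrow>\<^sub>M count_space UNIV"
  shows "Measurable.pred N (\<lambda>w. u \<in> gw_tree (h w))"
  using assms
proof (induction u arbitrary: h)
  case Nil
  then show ?case by (simp add: gw_tree.gw_root)
next
  case (Cons i u)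
  note [measurable] = Cons.prems Cons.IH[of "\<lambda>w v. h w (i # v)", OF Cons.prems]
  show ?case unfolding gw_tree_Cons by measurable
qed

lemma measurable_egwt_code: "egwt_code \<in> egwt_source p \<rightarrow>\<^sub>M tree_space"
proof -
  have fst: "(\<lambda>w. fst w n) \<in> egwt_source p \<rightarrow>\<^sub>M count_space UNIV" for n
  proof -
    have "(\<lambda>w. fst w n) \<in> egwt_source p \<rightarrow>\<^sub>M measure_pmf (spine_pmf p)"
      unfolding egwt_source_def
      by (rule measurable_compose[OF measurable_fst measurable_component_singleton]) simp
    then show ?thesis by simp
  qed
  have snd: "(\<lambda>w. snd w i) \<in> egwt_source p \<rightarrow>\<^sub>M count_space UNIV" for i
  proof -
    have "(\<lambda>w. snd w i) \<in> egwt_source p \<rightarrow>\<^sub>M measure_pmf p"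
      unfolding egwt_source_def
      by (rule measurable_compose[OF measurable_snd measurable_component_singleton]) simp
    then show ?thesis by simp
  qed
  note [measurable] = fst snd
  have pos [measurable]: "(\<lambda>w. snd (fst w n)) \<in> egwt_source p \<rightarrow>\<^sub>M count_space UNIV"
    and num [measurable]: "(\<lambda>w. fst (fst w n)) \<in> egwt_source p \<rightarrow>\<^sub>M count_space UNIV" for n
    by (rule measurable_compose[OF fst], simp)+
  have D: "Measurable.pred (egwt_source p) (\<lambda>w. u \<in> egwt_D w n)" for n u
  proof (induction n arbitrary: u)
    case 0
    show ?case by (simp add: measurable_gw_tree snd)
  next
    case (Suc n)
    show ?case
    proof (cases u)
      case Nil
      then show ?thesis by simp
    next
      case (Cons i v)
      note [measurable] = Suc[of v]
        measurable_gw_tree[of "\<lambda>w v. snd w (Suc n, i # v)" "egwt_source p" v, OF snd]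
      have "u \<in> egwt_D w (Suc n) \<longleftrightarrow>
          (i = snd (fst w n) \<and> v \<in> egwt_D w n) \<or>
          (i < fst (fst w n) \<and> i \<noteq> snd (fst w n) \<and> v \<in> gw_tree (\<lambda>v. snd w (Suc n, i # v)))" for w
        by (auto simp: Cons)
      moreover have "Measurable.pred (egwt_source p) (\<lambda>w.
          (i = snd (fst w n) \<and> v \<in> egwt_D w n) \<or>
          (i < fst (fst w n) \<and> i \<noteq> snd (fst w n) \<and> v \<in> gw_tree (\<lambda>v. snd w (Suc n, i # v))))"
        by measurable
      ultimately show ?thesis by simp
    qed
  qed
  show ?thesis
    by (rule measurable_tree_spaceI) (simp_all add: egwt_code_def pos D)
qed

lemma measurable_sum_int:
  fixes f :: "'i \<Rightarrow> 'a \<Rightarrow> int"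
  assumes "\<And>i. f i \<in> M \<rightarrow>\<^sub>M count_space UNIV" "finite A"
  shows "(\<lambda>\<omega>. \<Sum>i\<in>A. f i \<omega>) \<in> M \<rightarrow>\<^sub>M count_space UNIV"
  using assms(2)
proof (induction A rule: finite_induct)
  case (insert i A)
  have "(\<lambda>\<omega>. m + (\<Sum>i\<in>A. f i \<omega>)) \<in> M \<rightarrow>\<^sub>M count_space UNIV" for m
    using insert.IH by (rule measurable_compose) simp
  then have "(\<lambda>\<omega>. f i \<omega> + (\<Sum>i\<in>A. f i \<omega>)) \<in> M \<rightarrow>\<^sub>M count_space UNIV"
    using assms(1)[of i] by (rule measurable_compose_countable)
  then show ?case using insert.hyps by simp
qed simp

lemma measurable_countable_valueI:
  fixes f :: "'a \<Rightarrow> 'b::countable"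
  assumes "\<And>a. Measurable.pred M (\<lambda>\<omega>. f \<omega> = a)"
  shows "f \<in> M \<rightarrow>\<^sub>M count_space UNIV"
proof -
  have "f -` {a} \<inter> space M \<in> sets M" for a
    using predE[OF assms[of a]] by (simp add: vimage_def Int_def conj_commute)
  then show ?thesis by (simp add: measurable_count_space_eq2_countable)
qed

text \<open>A countable union over path lengths, each step of which passes through a countable
  vertex set.\<close>

lemma measurable_rtrancl:
  fixes r :: "'a \<Rightarrow> ('b::countable \<times> 'b) set"
  assumes "\<And>a b. Measurable.pred M (\<lambda>\<omega>. (a, b) \<in> r \<omega>)"
  shows "Measurable.pred M (\<lambda>\<omega>. (a, b) \<in> (r \<omega>)\<^sup>*)"
proof -
  have n: "Measurable.pred M (\<lambda>\<omega>. (a, b) \<in> r \<omega> ^^ n)" for n b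
  proof (induction n arbitrary: b)
    case (Suc n)
    note [measurable] = Suc assms
    have "Measurable.pred M (\<lambda>\<omega>. \<exists>c. (a, c) \<in> r \<omega> ^^ n \<and> (c, b) \<in> r \<omega>)"
      by measurable
    then show ?case by (simp add: relcomp_unfold)
  qed simp
  note [measurable] = n
  have "Measurable.pred M (\<lambda>\<omega>. \<exists>n. (a, b) \<in> r \<omega> ^^ n)" by measurable
  then show ?thesis by (simp add: rtrancl_is_UN_relpow)
qed

text \<open>The second alternative is the default value \<open>[]\<close> on infinite sets: being
  the set of no list is finiteness negated, in a form that quantifies over countably many
  lists.\<close>

lemma sorted_list_of_set_eq_iff:
  fixes A :: "'b::linorder set"
  shows "sorted_list_of_set A = l \<longleftrightarrow>
    (set l = A \<and> sorted l \<and> distinct l) \<or> ((\<forall>l. set l \<noteq> A) \<and> l = [])"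
proof (cases "finite A")
  case True
  then have "\<not> (\<forall>l. set l \<noteq> A)" using finite_list by blast
  moreover have "sorted_list_of_set A = l" if "set l = A" "sorted l" "distinct l"
    using sorted_list_of_set.idem_if_sorted_distinct[OF that(2,3)] that(1) by simp
  moreover have "set l = A \<and> sorted l \<and> distinct l" if "sorted_list_of_set A = l"
    using True by (simp flip: that)
  ultimately show ?thesis by blast
next
  case False
  then have "set l \<noteq> A" for l by (metis List.finite_set)
  then show ?thesis using False by (auto simp: eq_commute)
qed

lemma measurable_sorted_list_of_set:
  fixes S :: "'a \<Rightarrow> 'b::{countable, linorder} set"
  assumes "\<And>u. Measurable.pred M (\<lambda>\<omega>. u \<in> S \<omega>)"
  shows "(\<lambda>\<omega>. sorted_list_of_set (S \<omega>)) \<in> M \<rightarrow>\<^sub>M count_space UNIV"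
proof -
  note [measurable] = assms
  have eq [measurable]: "Measurable.pred M (\<lambda>\<omega>. set l = S \<omega>)" for l
    unfolding set_eq_iff by measurable
  have "Measurable.pred M (\<lambda>\<omega>. sorted_list_of_set (S \<omega>) = l)" for l
    unfolding sorted_list_of_set_eq_iff by measurable
  then show ?thesis by (rule measurable_countable_valueI)
qed

context
  fixes M :: "'a measure" and X :: "int \<Rightarrow> 'a \<Rightarrow> int"
  assumes X: "\<And>n. X n \<in> M \<rightarrow>\<^sub>M count_space UNIV"
begin

lemma measurable_record_map: "(\<lambda>\<omega>. record_map (\<lambda>n. X n \<omega>) i) \<in> M \<rightarrow>\<^sub>M count_space UNIV"
proof -
  have "(\<lambda>\<omega>. rec_y (\<lambda>n. X n \<omega>) i j) \<in> M \<rightarrow>\<^sub>M count_space UNIV" for i j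
    unfolding rec_y_def using X by (intro measurable_sum_int) auto
  note [measurable] = this
  have "Measurable.pred M (\<lambda>\<omega>. record_map (\<lambda>n. X n \<omega>) i = j)" for j
    unfolding record_map_eq_iff by measurable
  then show ?thesis by (rule measurable_countable_valueI)
qed

lemma measurable_record_component: "Measurable.pred M (\<lambda>\<omega>. j \<in> record_component (\<lambda>n. X n \<omega>) i)"
proof -
  note [measurable] = measurable_record_map
  have "Measurable.pred M (\<lambda>\<omega>. (a, b) \<in> record_edges (\<lambda>n. X n \<omega>) \<union> (record_edges (\<lambda>n. X n \<omega>))\<inverse>)" for a b
  proof -
    have "(a, b) \<in> record_edges x \<union> (record_edges x)\<inverse> \<longleftrightarrow>
        a \<noteq> b \<and> (record_map x a = b \<or> record_map x b = a)" for x
      by (auto simp: record_edges_def)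
    then show ?thesis by simp
  qed
  then show ?thesis
    unfolding record_component_def mem_Collect_eq by (rule measurable_rtrancl)
qed

lemma measurable_record_children:
  "(\<lambda>\<omega>. ft_children (record_component (\<lambda>n. X n \<omega>) 0) (record_map (\<lambda>n. X n \<omega>)) v) \<in> M \<rightarrow>\<^sub>M count_space UNIV"
proof -
  note [measurable] = measurable_record_map measurable_record_component
  show ?thesis
    unfolding ft_children_def by (rule measurable_sorted_list_of_set) simp
qed

lemma measurable_record_addr_ok:
  "Measurable.pred M (\<lambda>\<omega>. ft_addr_ok (record_component (\<lambda>n. X n \<omega>) 0) (record_map (\<lambda>n. X n \<omega>)) v u)"
proof (induction u arbitrary: v)
  case (Cons i u)
  \<comment> \<open>The random list of children is frozen to a fixed \<open>cs\<close>; integer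
    lists are countable, so the pieces glue to a measurable whole.\<close>
  have "(\<lambda>\<omega>. ft_addr_ok (record_component (\<lambda>n. X n \<omega>) 0) (record_map (\<lambda>n. X n \<omega>)) (cs ! i) u)
      \<in> M \<rightarrow>\<^sub>M count_space UNIV" for cs
    by (rule Cons)
  then have "(\<lambda>\<omega>. i < length cs \<and> ft_addr_ok (record_component (\<lambda>n. X n \<omega>) 0) (record_map (\<lambda>n. X n \<omega>)) (cs ! i) u)
      \<in> M \<rightarrow>\<^sub>M count_space UNIV" for cs :: "int list"
    by simp
  from measurable_compose_countable[OF this measurable_record_children[of v]]
  show ?case by simp
qed simp

lemma measurable_record_pos:
  "(\<lambda>\<omega>. ft_pos (record_component (\<lambda>n. X n \<omega>) 0) (record_map (\<lambda>n. X n \<omega>)) v) \<in> M \<rightarrow>\<^sub>M count_space UNIV"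
proof -
  have "(\<lambda>\<omega>. LEAST i. i < length cs \<and> cs ! i = v) \<in> M \<rightarrow>\<^sub>M count_space UNIV" for cs
    by simp
  from measurable_compose_countable[OF this measurable_record_children]
  have "(\<lambda>\<omega>. LEAST i. i < length (ft_children (record_component (\<lambda>n. X n \<omega>) 0) (record_map (\<lambda>n. X n \<omega>)) w) \<and>
      ft_children (record_component (\<lambda>n. X n \<omega>) 0) (record_map (\<lambda>n. X n \<omega>)) w ! i = v) \<in> M \<rightarrow>\<^sub>M count_space UNIV" for w .
  from measurable_compose_countable[OF this measurable_record_map[of v]]
  show ?thesis unfolding ft_pos_def .
qed

lemma measurable_record_iterate:
  "(\<lambda>\<omega>. (record_map (\<lambda>n. X n \<omega>) ^^ k) v) \<in> M \<rightarrow>\<^sub>M count_space UNIV"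
proof (induction k)
  case (Suc k)
  from measurable_compose_countable[OF measurable_record_map Suc] show ?case by simp
qed simp

lemma measurable_record_code: "(\<lambda>\<omega>. record_code (\<lambda>n. X n \<omega>)) \<in> M \<rightarrow>\<^sub>M tree_space"
  using measurable_compose_countable[OF measurable_record_pos measurable_record_iterate]
    measurable_compose_countable[OF measurable_record_addr_ok measurable_record_iterate]
  by (intro measurable_tree_spaceI) (simp_all add: record_code_def ft_code_def)

text \<open>A nonempty word gives a nonempty index set, which \<open>indep_varsD\<close> asks for
  and which keeps the intersection inside \<open>space M\<close>.\<close>

lemma reads_cylinder:
  fixes p :: "nat pmf"
  assumes prob: "prob_space M"
    and indep: "prob_space.indep_vars M (\<lambda>_. count_space UNIV) X UNIV"
    and law: "\<And>n d. emeasure M {\<omega> \<in> space M. X n \<omega> = int d - 1} = ennreal (pmf p d)"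
    and "ds \<noteq> []"
  shows "{\<omega> \<in> space M. reads (\<lambda>n. X n \<omega>) a ds} \<in> sets M"
    "emeasure M {\<omega> \<in> space M. reads (\<lambda>n. X n \<omega>) a ds} = ennreal (\<Prod>d\<leftarrow>ds. pmf p d)"
proof -
  interpret prob_space M by (rule prob)
  define J where "J = (\<lambda>i. a + int i) ` {..<length ds}"
  define A where "A j = {int (ds ! nat (j - a)) - 1}" for j
  have eq: "{\<omega> \<in> space M. reads (\<lambda>n. X n \<omega>) a ds} = (\<Inter>j\<in>J. X j -` A j \<inter> space M)"
    using assms(4) by (auto simp: reads_def J_def A_def)
  have sets: "X j -` A j \<inter> space M \<in> sets M" for j
    using X by (rule measurable_sets) simp
  have J: "J \<noteq> {}" "finite J" using assms(4) by (auto simp: J_def)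
  show "{\<omega> \<in> space M. reads (\<lambda>n. X n \<omega>) a ds} \<in> sets M"
    unfolding eq using J sets by (intro sets.finite_INT) auto
  have "prob (X (a + int i) -` A (a + int i) \<inter> space M) = pmf p (ds ! i)" for i
  proof -
    have "X (a + int i) -` A (a + int i) \<inter> space M = {\<omega> \<in> space M. X (a + int i) \<omega> = int (ds ! i) - 1}"
      by (auto simp: A_def)
    then show ?thesis using law[of "a + int i" "ds ! i"] by (simp add: measure_def)
  qed
  then have "prob (\<Inter>j\<in>J. X j -` A j \<inter> space M) = (\<Prod>i<length ds. pmf p (ds ! i))"
    using indep_varsD[OF indep J] by (simp add: J_def prod.reindex inj_on_def)
  then show "emeasure M {\<omega> \<in> space M. reads (\<lambda>n. X n \<omega>) a ds} = ennreal (\<Prod>d\<leftarrow>ds. pmf p d)"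
    unfolding eq by (simp add: emeasure_eq_measure prod.list_conv_set_nth atLeast0LessThan)
qed

end

theorem theorem4p20:
  fixes M :: "'a measure" and X :: "int \<Rightarrow> 'a \<Rightarrow> int" and p :: "nat pmf"
  assumes "prob_space M"
    and "\<And>n. X n \<in> measurable M (count_space UNIV)"
    and "prob_space.indep_vars M (\<lambda>_. count_space UNIV) X UNIV"
    and "\<And>n. distr M (count_space UNIV) (X n) = distr M (count_space UNIV) (X 0)"
    and "\<And>n \<omega>. \<omega> \<in> space M \<Longrightarrow> X n \<omega> \<ge> -1"
    and "measure M {\<omega> \<in> space M. X 0 \<omega> = -1} > 0"
    and "integrable M (\<lambda>\<omega>. real_of_int (X 0 \<omega>))"
    and "(\<integral>\<omega>. real_of_int (X 0 \<omega>) \<partial>M) = 0"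
    and "measure_pmf p = distr M (count_space UNIV) (\<lambda>\<omega>. nat (X 0 \<omega> + 1))"
  shows "distr M tree_space (\<lambda>\<omega>. record_code (\<lambda>n. X n \<omega>)) = EGWT p"
proof -
  interpret prob_space M by fact
  have K: "(\<lambda>\<omega>. nat (X 0 \<omega> + 1)) \<in> M \<rightarrow>\<^sub>M count_space UNIV"
    using assms(2)[of 0] by (rule measurable_compose) simp
  have law: "emeasure M {\<omega> \<in> space M. X n \<omega> = int d - 1} = ennreal (pmf p d)" for n d
  proof -
    have "emeasure M {\<omega> \<in> space M. X n \<omega> = int d - 1} =
        emeasure (distr M (count_space UNIV) (X n)) {int d - 1}"
      using assms(2)[of n] by (simp add: emeasure_distr vimage_def Int_def conj_commute)
    also have "\<dots> = emeasure (distr M (count_space UNIV) (X 0)) {int d - 1}"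
      by (simp only: assms(4)[of n])
    also have "\<dots> = emeasure M (X 0 -` {int d - 1} \<inter> space M)"
      using assms(2)[of 0] by (simp add: emeasure_distr)
    \<comment> \<open>The bound \<open>X 0 \<omega> \<ge> -1\<close> keeps \<open>nat\<close> from
      truncating, also for \<open>d = 0\<close>.\<close>
    also have "X 0 -` {int d - 1} \<inter> space M = (\<lambda>\<omega>. nat (X 0 \<omega> + 1)) -` {d} \<inter> space M"
      using assms(5)[of _ 0] by force
    also have "emeasure M \<dots> = emeasure (measure_pmf p) {d}"
      using K by (simp add: assms(9) emeasure_distr)
    finally show ?thesis by (simp add: emeasure_pmf_single)
  qed
  have pos: "0 < pmf p 0"
    using law[of 0 0] assms(6) by (simp add: measure_def)
  have mean: "(\<integral>\<^sup>+k. ennreal (real k) \<partial>measure_pmf p) = 1"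
  proof -
    have "(\<integral>\<^sup>+k. ennreal (real k) \<partial>measure_pmf p) = (\<integral>\<^sup>+\<omega>. ennreal (real (nat (X 0 \<omega> + 1))) \<partial>M)"
      unfolding assms(9) using K by (rule nn_integral_distr) simp
    also have "\<dots> = (\<integral>\<^sup>+\<omega>. ennreal (real_of_int (X 0 \<omega>) + 1) \<partial>M)"
      using assms(5)[of _ 0] by (intro nn_integral_cong) (force simp: of_nat_nat)
    also have "\<dots> = ennreal (\<integral>\<omega>. real_of_int (X 0 \<omega>) + 1 \<partial>M)"
      using assms(5)[of _ 0] assms(7) by (intro nn_integral_eq_integral) (force intro!: AE_I2)+
    also have "(\<integral>\<omega>. real_of_int (X 0 \<omega>) + 1 \<partial>M) = 1"
      using assms(7,8) by (simp add: prob_space)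
    finally show ?thesis by simp
  qed
  have "postorder t \<noteq> []" for t
    using length_postorder_pos[of t] by auto
  note cyl = reads_cylinder[OF assms(2,1,3) law this]
  show ?thesis
    unfolding EGWT_def
  proof (rule law_unique[OF mean pos, where E' = egwt_cylinder])
    show "prob_space M" by fact
    show "(\<lambda>\<omega>. record_code (\<lambda>n. X n \<omega>)) \<in> M \<rightarrow>\<^sub>M tree_space"
      using assms(2) by (rule measurable_record_code)
    \<comment> \<open>The root 0 is the right end of the word of \<open>t\<close>; the window starts
      to its left by the length of that word plus the left branches.\<close>
    let ?E = "\<lambda>t zs. {\<omega> \<in> space M. reads (\<lambda>n. X n \<omega>)
      (- int (length (postorder t)) - int (left_size zs)) (postorder (fold graft zs t))}"
    show "?E t zs \<in> sets M" for t zs by (rule cyl)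
    show "emeasure M (?E t zs) = ennreal (weight p (fold graft zs t))" for t zs
      unfolding weight_def by (rule cyl)
    show "\<omega> \<in> ?E t zs \<Longrightarrow> code_agrees t zs (record_code (\<lambda>n. X n \<omega>))" for t zs \<omega>
      by (simp add: record_code_agrees)
  qed (use prob_space_egwt_source measurable_egwt_code emeasure_egwt_cylinder[OF mean]
      egwt_cylinder_agrees in auto)
qed

end
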